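(* Let $H\in(0,1)$ and let $B_H=\{B_H(t),\,t\in\mathbb{R}\}$ be a fractional Brownian motion of index $H$, with $\sigma^2=\mathrm{Var}(B_H(1))$. Let $D=\{D(u),\,u\ge 0\}$ be a subordinator (not identically zero) with Laplace exponent $\phi$, let $Y(t)=\inf\{u: D(u)>t\}$, $t\ge 0$, be its inverse subordinator, and assume that $Y$ is independent of $B_H$. Let $Z(t)=B_H(Y(t))$, $t\ge 0$. Then for all $t,s\ge 0$, $$\mathrm{Cov}\left(Z(t),Z(s)\right)=\frac{\sigma^2}{2}\left\{U^{2H}(\min(t,s))+2H\int_{[0,\min(t,s)]}U^{2H-1}(\max(t,s)-y)\,dU(y)\right\},$$ where $U^{\gamma}(x)=\mathbb{E}[Y(x)^{\gamma}]$ for $\gamma>-1$ and $U(x)=U^{1}(x)=\mathbb{E}[Y(x)]$.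
   Context: A fractional Brownian motion of index (Hurst parameter) $H\in(0,1)$ is a Gaussian process $B_H$ with mean zero, continuous sample paths and covariance $\mathbb{E}[B_H(t)B_H(s)]=\frac{\sigma^2}{2}\left(|s|^{2H}+|t|^{2H}-|t-s|^{2H}\right)$, where $\sigma^2=\mathrm{Var}(B_H(1))$. A subordinator $D=\{D(u),u\ge 0\}$ is a non-decreasing real-valued Lévy process with $D(0)=0$, right-continuous with left limits. It has stationary independent increments and $\mathbb{E}[e^{-\lambda D(u)}]=e^{-u\phi(\lambda)}$ for $\lambda\ge 0$, where the Laplace exponent is $\phi(\lambda)=\mu\lambda+\int_{(0,\infty)}(1-e^{-\lambda x})\,v(dx)$ with drift $\mu\ge 0$ and Lévy measure $v$ satisfying $\int_{(0,\infty)}\min(1,x)\,v(dx)<\infty$. The subordinator is not identically zero, i.e. $\phi\not\equiv 0$. The superscript in $U^{\gamma}$ is an index (the order of the moment), not a power of the function $U$: $U^\gamma(x)=\mathbb{E}[Y(x)^\gamma]$, a value in $[0,\infty]$ when $\gamma<0$, and $U^0\equiv 1$. The integral with respect to $dU$ is the Lebesgue–Stieltjes integral with respect to the non-decreasing right-continuous function $U$ on $[0,\infty)$, with $U(0-)=0$ (so that a possible atom of mass $U(0)$ at $0$ is included), with the usual measure-theoretic convention that sets of measure zero contribute $0$. *)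

theory Defs
  imports "HOL-Probability.Probability"
begin

definition covariance :: "'w measure \<Rightarrow> ('w \<Rightarrow> real) \<Rightarrow> ('w \<Rightarrow> real) \<Rightarrow> real" where
  "covariance M X Y =
     (LINT \<omega>|M. (X \<omega> - (LINT \<omega>|M. X \<omega>)) * (Y \<omega> - (LINT \<omega>|M. Y \<omega>)))"

text \<open>A Gaussian law may be degenerate, i.e. a point mass; \<^const>\<open>normal_density\<close> only covers
  positive variance.\<close>

definition gaussian_rv :: "'w measure \<Rightarrow> ('w \<Rightarrow> real) \<Rightarrow> bool" where
  "gaussian_rv M X \<longleftrightarrow>
     X \<in> borel_measurable M \<and>
     (\<exists>m s. 0 < s \<and> distributed M lborel X (\<lambda>x. ennreal (normal_density m s x)) \<or>
            (AE \<omega> in M. X \<omega> = m))"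

definition gaussian_process :: "'w measure \<Rightarrow> (real \<Rightarrow> 'w \<Rightarrow> real) \<Rightarrow> bool" where
  "gaussian_process M X \<longleftrightarrow>
     (\<forall>T c. finite T \<longrightarrow> gaussian_rv M (\<lambda>\<omega>. \<Sum>t\<in>T. c t * X t \<omega>))"

definition fractional_brownian_motion ::
    "'w measure \<Rightarrow> real \<Rightarrow> (real \<Rightarrow> 'w \<Rightarrow> real) \<Rightarrow> bool" where
  "fractional_brownian_motion M H B \<longleftrightarrow>
     gaussian_process M B \<and>
     (\<forall>t. (LINT \<omega>|M. B t \<omega>) = 0) \<and>
     (\<forall>\<omega>\<in>space M. continuous_on UNIV (\<lambda>t. B t \<omega>)) \<and>
     (\<forall>t s. (LINT \<omega>|M. B t \<omega> * B s \<omega>) =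
        covariance M (B 1) (B 1) / 2 *
          (\<bar>s\<bar> powr (2 * H) + \<bar>t\<bar> powr (2 * H) - \<bar>t - s\<bar> powr (2 * H)))"

text \<open>The L\'evy measure is a Borel measure on the line that does not charge the complement of
  \<open>(0, \<infinity>)\<close>.\<close>

definition subordinator_levy_measure :: "real measure \<Rightarrow> bool" where
  "subordinator_levy_measure v \<longleftrightarrow>
     sets v = sets borel \<and> emeasure v {..0} = 0 \<and>
     (\<integral>\<^sup>+x\<in>{0<..}. ennreal (min 1 x) \<partial>v) < \<infinity>"

definition laplace_exponent_form :: "(real \<Rightarrow> real) \<Rightarrow> bool" where
  "laplace_exponent_form \<phi> \<longleftrightarrow>
     (\<exists>\<mu> v. 0 \<le> \<mu> \<and> subordinator_levy_measure v \<and>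
        (\<forall>l\<ge>0. \<phi> l = \<mu> * l + (LINT x:{0<..}|v. 1 - exp (- l * x))))"

text \<open>The process is indexed by \<open>real\<close>, but only its values at times \<open>u \<ge> 0\<close> are constrained
  or used. Path properties hold for every outcome.\<close>

definition subordinator ::
    "'w measure \<Rightarrow> (real \<Rightarrow> 'w \<Rightarrow> real) \<Rightarrow> (real \<Rightarrow> real) \<Rightarrow> bool" where
  "subordinator M D \<phi> \<longleftrightarrow>
     (\<forall>u\<ge>0. D u \<in> borel_measurable M) \<and>
     (\<forall>\<omega>\<in>space M. D 0 \<omega> = 0 \<and> mono_on {0..} (\<lambda>u. D u \<omega>) \<and>
        (\<forall>u\<ge>0. continuous (at_right u) (\<lambda>u. D u \<omega>)) \<and>
        (\<forall>u>0. \<exists>l. ((\<lambda>u. D u \<omega>) \<longlongrightarrow> l) (at_left u))) \<and>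
     (\<forall>u\<ge>0. \<forall>h\<ge>0. distr M borel (\<lambda>\<omega>. D (u + h) \<omega> - D u \<omega>) = distr M borel (D h)) \<and>
     (\<forall>(n::nat) u. 0 \<le> u 0 \<and> (\<forall>i<n. u i \<le> u (Suc i)) \<longrightarrow>
        prob_space.indep_vars M (\<lambda>_. borel) (\<lambda>i \<omega>. D (u (Suc i)) \<omega> - D (u i) \<omega>) {..<n}) \<and>
     laplace_exponent_form \<phi> \<and>
     (\<forall>u\<ge>0. \<forall>l\<ge>0. (LINT \<omega>|M. exp (- l * D u \<omega>)) = exp (- u * \<phi> l))"

text \<open>The first-passage time is taken in \<open>[0, \<infinity>]\<close>, so that \<open>inf {} = \<infinity>\<close>.\<close>

definition inverse_subordinator :: "(real \<Rightarrow> 'w \<Rightarrow> real) \<Rightarrow> real \<Rightarrow> 'w \<Rightarrow> ennreal" where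
  "inverse_subordinator D t \<omega> = (INF u\<in>{u. 0 \<le> u \<and> D u \<omega> > t}. ennreal u)"

text \<open>Independence of two processes means independence of the \<open>\<sigma>\<close>-algebras they generate. (The
  library's \<open>indep_var\<close> needs both random variables to have the same value type.)\<close>

definition process_sigma ::
    "'w measure \<Rightarrow> 'i set \<Rightarrow> ('i \<Rightarrow> 'w \<Rightarrow> 'b::topological_space) \<Rightarrow> 'w set set" where
  "process_sigma M I X =
     sets (vimage_algebra (space M) (\<lambda>\<omega>. \<lambda>i\<in>I. X i \<omega>) (Pi\<^sub>M I (\<lambda>_. borel)))"

text \<open>A null event \<open>{Y t = \<infinity>}\<close> is sent to \<open>B 0\<close> by the convention for \<^const>\<open>enn2real\<close>.\<close>

definition time_changed ::
    "(real \<Rightarrow> 'w \<Rightarrow> real) \<Rightarrow> (real \<Rightarrow> 'w \<Rightarrow> ennreal) \<Rightarrow> real \<Rightarrow> 'w \<Rightarrow> real" where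
  "time_changed B Y t \<omega> = B (enn2real (Y t \<omega>)) \<omega>"

text \<open>Real powers on \<open>[0, \<infinity>]\<close>: \<open>y\<^sup>0 = 1\<close> also at \<open>0\<close> and \<open>\<infinity>\<close> (unlike \<^const>\<open>powr\<close>, where
  \<open>0 powr 0 = 0\<close>), and \<open>0\<^sup>\<gamma> = \<infinity>\<close> for \<open>\<gamma> < 0\<close>.\<close>

definition ennpowr :: "ennreal \<Rightarrow> real \<Rightarrow> ennreal" where
  "ennpowr y \<gamma> =
     (if \<gamma> = 0 then 1
      else if y = 0 then (if \<gamma> < 0 then \<infinity> else 0)
      else if y = \<infinity> then (if \<gamma> < 0 then 0 else \<infinity>)
      else ennreal (enn2real y powr \<gamma>))"

definition inv_moment :: "'w measure \<Rightarrow> (real \<Rightarrow> 'w \<Rightarrow> ennreal) \<Rightarrow> real \<Rightarrow> real \<Rightarrow> ennreal" where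
  "inv_moment M Y \<gamma> x = (\<integral>\<^sup>+\<omega>. ennpowr (Y x \<omega>) \<gamma> \<partial>M)"

text \<open>The Lebesgue--Stieltjes measure \<open>dU\<close>. Extending \<open>U\<close> by \<open>0\<close> to the negative half-line puts
  mass \<open>U 0\<close> at the origin. For an inverse subordinator \<open>U\<close> is finite, so \<^const>\<open>enn2real\<close>
  loses nothing.\<close>

definition renewal_measure :: "'w measure \<Rightarrow> (real \<Rightarrow> 'w \<Rightarrow> ennreal) \<Rightarrow> real measure" where
  "renewal_measure M Y =
     interval_measure (\<lambda>x. if x < 0 then 0 else enn2real (inv_moment M Y 1 x))"

end

theory Submission
  imports Defs
begin

text \<open>
  Conditioning on \<open>Y\<close> and using the covariance of \<open>B\<close> gives, for \<open>s \<le> t\<close>,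
  \<open>Cov(Z t, Z s) = \<sigma>\<^sup>2/2 \<cdot> E[Y s\<^sup>2\<^sup>H + Y t\<^sup>2\<^sup>H - (Y t - Y s)\<^sup>2\<^sup>H]\<close>. Pathwise,
  \<open>Y t\<^sup>p - (Y t - Y s)\<^sup>p\<close> is the integral of \<open>p (Y t - u)\<^sup>p\<^sup>-\<^sup>1\<close> over \<open>0 \<le> u < Y s\<close>, and up to a
  single \<open>u\<close> the condition \<open>u < Y s\<close> means \<open>D u \<le> s\<close>. By the Markov property of \<open>D\<close> at the fixed
  time \<open>u\<close>, conditionally on \<open>D u = y\<close> the variable \<open>Y t - u\<close> has the law of \<open>Y (t - y)\<close>.
  Integrating over \<open>u\<close> turns the law of \<open>D u\<close> into the occupation measure of \<open>D\<close>, whose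
  distribution function is \<open>U\<close>.
\<close>

section \<open>Measures and power integrals\<close>

lemma ennreal_real_dense:
  assumes "ennreal u < a" "0 \<le> u"
  obtains v where "u < v" "ennreal v < a"
proof -
  obtain r where r: "ennreal u < r" "r < a" using dense[OF assms(1)] by blast
  then obtain v where "0 \<le> v" "r = ennreal v" by (cases r) auto
  then show thesis using that r assms(2) by (auto simp: ennreal_less_iff)
qed

text \<open>\<open>F\<close> is the distribution function of \<open>N\<close>, so it inherits
  monotonicity and right continuity from \<open>N\<close>. The two measures then agree on half-open
  intervals, an intersection-stable generator of the Borel sets.\<close>

lemma interval_measure_eqI:
  fixes F :: "real \<Rightarrow> real"
  assumes sets: "sets N = sets borel" and F: "\<And>x. 0 \<le> F x"
    and N: "\<And>x. emeasure N {..x} = ennreal (F x)"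
  shows "interval_measure F = N"
proof -
  have [simp]: "space N = UNIV" using sets_eq_imp_space_eq[OF sets] by simp
  note [measurable_cong] = sets
  have mono: "F x \<le> F y" if "x \<le> y" for x y
  proof -
    have "emeasure N {..x} \<le> emeasure N {..y}"
      using that by (intro emeasure_mono) (auto simp: sets)
    then show ?thesis by (simp add: N F)
  qed
  have cont: "continuous (at_right a) F" for a
  proof (rule continuous_at_right_real_increasing[THEN iffD2, OF mono], safe)
    fix e :: real assume "0 < e"
    \<comment> \<open>Continuity from above along rays shrinking to \<open>{..a}\<close>; the real
      values of \<open>F\<close> supply the finite mass this requires.\<close>
    have "(\<lambda>n. emeasure N {..a + 1 / Suc n}) \<longlonglongrightarrow> emeasure N (\<Inter>n. {..a + 1 / Suc n})"
    proof (rule Lim_emeasure_decseq)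
      show "decseq (\<lambda>n. {..a + 1 / real (Suc n)})"
        by (intro decseq_SucI) (simp add: frac_le)
    qed (auto simp: sets N)
    also have "(\<Inter>n. {..a + 1 / Suc n}) = {..a}"
    proof safe
      fix x assume *: "x \<in> (\<Inter>n. {..a + 1 / Suc n})"
      show "x \<le> a"
      proof (rule ccontr)
        assume "\<not> x \<le> a"
        then obtain n where "1 / Suc n < x - a"
          using reals_Archimedean[of "x - a"] by (auto simp: inverse_eq_divide)
        moreover have "x \<le> a + 1 / Suc n" using * by blast
        ultimately show False by simp
      qed
    qed (auto intro: add_increasing2)
    finally have "(\<lambda>n. F (a + 1 / Suc n)) \<longlonglongrightarrow> F a"
      by (simp add: N F tendsto_ennreal_iff)
    then have "\<forall>\<^sub>F n in sequentially. F (a + 1 / Suc n) < F a + e"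
      using \<open>0 < e\<close> by (intro order_tendstoD) auto
    then obtain n where "F (a + 1 / Suc n) < F a + e"
      by (auto simp: eventually_sequentially)
    then show "\<exists>d>0. F (a + d) - F a < e"
      by (intro exI[of _ "1 / Suc n"]) auto
  qed
  show ?thesis
  proof (rule measure_eqI_generator_eq)
    let ?E = "range (\<lambda>(a, b). {a<..b::real})"
    show "Int_stable ?E"
      by (auto simp: Int_stable_def)
    show "?E \<subseteq> Pow UNIV" by auto
    show "sets (interval_measure F) = sigma_sets UNIV ?E" "sets N = sigma_sets UNIV ?E"
      by (auto simp: sets borel_sigma_sets_Ioc)
    show "emeasure (interval_measure F) X = emeasure N X" if mem: "X \<in> ?E" for X
    proof -
      obtain a b where X: "X = {a<..b}" using mem by auto
      show ?thesis
      proof (cases "a \<le> b")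
        case True
        \<comment> \<open>Instead of subtracting in \<open>ennreal\<close>, the finite mass of
          \<open>{..a}\<close> is added to both sides and cancelled.\<close>
        have "emeasure N {a<..b} + ennreal (F a) = emeasure N ({a<..b} \<union> {..a})"
          by (subst N[symmetric], rule plus_emeasure) (auto simp: sets)
        also have "{a<..b} \<union> {..a} = {..b}" using True by auto
        also have "emeasure N {..b} = ennreal (F b - F a) + ennreal (F a)"
          using mono[OF True] by (simp add: N F flip: ennreal_plus)
        finally show ?thesis
          using True by (simp add: X emeasure_interval_measure_Ioc mono cont)
      qed (simp add: X)
    qed
    show "range (\<lambda>n::nat. {- real n<..real n}) \<subseteq> ?E" by auto
    show "(\<Union>n::nat. {- real n<..real n}) = UNIV"
    proof safe
      fix x :: real
      obtain n where "\<bar>x\<bar> < real n" using reals_Archimedean2 by blast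
      then show "x \<in> (\<Union>n::nat. {- real n<..real n})" by (intro UN_I[of n]) auto
    qed auto
    show "emeasure (interval_measure F) {- real n<..real n} \<noteq> \<infinity>" for n
      by (simp add: emeasure_interval_measure_Ioc mono cont)
  qed
qed

text \<open>Open upper rays generate the Borel sets of \<open>[0, \<infinity>]\<close> and are
  stable under intersection. No ray contains \<open>0\<close>, so the whole space joins the
  generator and total mass is compared separately.\<close>

lemma measure_ennreal_eqI:
  fixes M N :: "ennreal measure"
  assumes sets: "sets M = sets borel" "sets N = sets borel"
    and fin: "emeasure M UNIV \<noteq> \<infinity>" and UNIV: "emeasure M UNIV = emeasure N UNIV"
    and eq: "\<And>a::real. 0 \<le> a \<Longrightarrow> emeasure M {ennreal a<..} = emeasure N {ennreal a<..}"
  shows "M = N"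
proof (rule measure_eqI_generator_eq)
  let ?E = "insert UNIV (range (\<lambda>a::ennreal. {a<..}))"
  show "Int_stable ?E"
  proof (rule Int_stableI)
    fix A B assume "A \<in> ?E" "B \<in> ?E"
    moreover have "{a<..} \<inter> {b<..} \<in> ?E" for a b :: ennreal
      by (rule insertI2, rule range_eqI[of _ _ "max a b"]) auto
    ultimately show "A \<inter> B \<in> ?E" by auto
  qed
  show "?E \<subseteq> Pow UNIV" by simp
  have "sigma_sets UNIV ?E = sigma_sets UNIV (range (\<lambda>a::ennreal. {a<..}))"
  proof (rule sigma_sets_eqI)
    fix a assume "a \<in> ?E"
    then show "a \<in> sigma_sets UNIV (range (\<lambda>a::ennreal. {a<..}))"
      using sigma_sets_top sigma_sets.Basic by (elim insertE) simp_all
  next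
    fix b assume "b \<in> range (\<lambda>a::ennreal. {a<..})"
    then show "b \<in> sigma_sets UNIV ?E"
      by (intro sigma_sets.Basic insertI2)
  qed
  also have "\<dots> = sets borel"
    by (subst borel_Ioi) simp
  finally show "sets M = sigma_sets UNIV ?E" "sets N = sigma_sets UNIV ?E"
    by (simp_all add: sets)
  fix X assume "X \<in> ?E"
  then consider "X = UNIV" | a where "X = {a<..}" by auto
  then show "emeasure M X = emeasure N X"
  proof cases
    fix a assume "X = {a<..}"
    moreover have "{top<..} = ({} :: ennreal set)" by (simp add: set_eq_iff)
    ultimately show ?thesis using eq by (cases a) auto
  qed (use UNIV in simp)
next
  show "range (\<lambda>_::nat. UNIV) \<subseteq> insert UNIV (range (\<lambda>a::ennreal. {a<..}))" by simp
qed (use fin in simp_all)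

section \<open>Integrals of real powers\<close>

lemma nn_integral_powr:
  assumes "0 < p" "0 \<le> c"
  shows "ennreal p * (\<integral>\<^sup>+x. indicator {0..c} x * ennreal (x powr (p - 1)) \<partial>lborel) = ennreal (c powr p)"
proof -
  have "(\<integral>\<^sup>+x. indicator {0..c} x * ennreal (x powr (p - 1)) \<partial>lborel) =
        (\<integral>\<^sup>+x. ennreal (indicator {0..c} x * (x powr (p - 1))) \<partial>lborel)"
    by (intro nn_integral_cong) (auto split: split_indicator)
  also have "\<dots> = ennreal (c powr p / p)"
    using nn_integral_has_integral_lebesgue[OF _ has_integral_powr_from_0[of "p - 1" c]] assms by simp
  finally show ?thesis
    using assms by (simp flip: ennreal_mult)
qed

lemma ennpowr_pos: "0 < x \<Longrightarrow> ennpowr (ennreal x) \<gamma> = ennreal (x powr \<gamma>)"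
  by (simp add: ennpowr_def)

lemma ennpowr_nonneg: "0 \<le> x \<Longrightarrow> 0 < \<gamma> \<Longrightarrow> ennpowr (ennreal x) \<gamma> = ennreal (x powr \<gamma>)"
  by (cases "x = 0") (simp_all add: ennpowr_def)

lemma ennpowr_one: "ennpowr y 1 = y"
  by (cases y) (simp_all add: ennpowr_def)

lemma borel_measurable_ennpowr [measurable (raw)]:
  "f \<in> borel_measurable N \<Longrightarrow> (\<lambda>x. ennpowr (f x) \<gamma>) \<in> borel_measurable N"
proof -
  have [measurable]: "Measurable.pred borel (\<lambda>y::ennreal. y = c)" for c
    by (simp add: pred_def)
  have "(\<lambda>y. ennpowr y \<gamma>) \<in> borel_measurable borel"
    unfolding ennpowr_def by (intro measurable_If) simp_all
  then show "f \<in> borel_measurable N \<Longrightarrow> (\<lambda>x. ennpowr (f x) \<gamma>) \<in> borel_measurable N"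
    by (rule measurable_compose[rotated])
qed

text \<open>The integral of \<open>p * x powr (p - 1)\<close> over \<open>{0..b}\<close> is split at
  \<open>b - a\<close>, and the upper piece is reflected by \<open>x = b - u\<close>. Excluding
  \<open>u = a\<close> keeps \<open>b - u\<close> positive, where \<open>ennpowr\<close> and
  \<open>powr\<close> agree; at \<open>0\<close> they differ if \<open>p \<le> 1\<close>.\<close>

lemma nn_integral_reflected_powr:
  assumes p: "0 < p" and a: "0 \<le> a" "a \<le> b"
  shows "ennreal (b powr p) = ennreal ((b - a) powr p) +
    ennreal p * (\<integral>\<^sup>+u. indicator {0..<a} u * ennpowr (ennreal (b - u)) (p - 1) \<partial>lborel)"
proof -
  have "ennreal (b powr p) = ennreal p * (\<integral>\<^sup>+x. indicator {0..b} x * ennreal (x powr (p - 1)) \<partial>lborel)"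
    using assms by (simp add: nn_integral_powr)
  also have "(\<integral>\<^sup>+x. indicator {0..b} x * ennreal (x powr (p - 1)) \<partial>lborel) =
     (\<integral>\<^sup>+x. indicator {0..b - a} x * ennreal (x powr (p - 1)) + indicator {b - a<..b} x * ennreal (x powr (p - 1)) \<partial>lborel)"
    using a by (intro nn_integral_cong) (auto split: split_indicator)
  also have "\<dots> = (\<integral>\<^sup>+x. indicator {0..b - a} x * ennreal (x powr (p - 1)) \<partial>lborel) +
     (\<integral>\<^sup>+x. indicator {b - a<..b} x * ennreal (x powr (p - 1)) \<partial>lborel)"
    by (intro nn_integral_add) auto
  also have "(\<integral>\<^sup>+x. indicator {b - a<..b} x * ennreal (x powr (p - 1)) \<partial>lborel) =
     (\<integral>\<^sup>+u. indicator {b - a<..b} (b - u) * ennreal ((b - u) powr (p - 1)) \<partial>lborel)"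
    by (subst nn_integral_real_affine[where c = "-1" and t = b]) auto
  also have "\<dots> = (\<integral>\<^sup>+u. indicator {0..<a} u * ennpowr (ennreal (b - u)) (p - 1) \<partial>lborel)"
    using a by (intro nn_integral_cong) (auto simp: ennpowr_pos split: split_indicator)
  finally show ?thesis
    using assms nn_integral_powr[OF p, of "b - a"] by (simp add: distrib_left)
qed

text \<open>A Gamma integral after the substitution \<open>t = c * u\<close>. It dominates the
  moments of the inverse subordinator.\<close>

lemma nn_integral_powr_exp_finite:
  assumes "0 < p" "0 < c"
  shows "(\<integral>\<^sup>+u. indicator {0..} u * ennreal (u powr (p - 1) * exp (- (c * u))) \<partial>lborel) < \<infinity>"
proof -
  let ?f = "\<lambda>t. ennreal (indicator {0..} t * t powr (p - 1) / exp t)"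
  have "ennreal (Gamma p) = (\<integral>\<^sup>+t. ?f t \<partial>lborel)"
    by (rule Gamma_conv_nn_integral_real[OF assms(1)])
  also have "\<dots> = ennreal c * (\<integral>\<^sup>+u. ?f (c * u) \<partial>lborel)"
    using assms by (subst nn_integral_real_affine[where c = c and t = 0]) auto
  also have "(\<integral>\<^sup>+u. ?f (c * u) \<partial>lborel) =
    (\<integral>\<^sup>+u. ennreal (c powr (p - 1)) * (indicator {0..} u * ennreal (u powr (p - 1) * exp (- (c * u)))) \<partial>lborel)"
  proof (intro nn_integral_cong)
    fix u
    show "?f (c * u) = ennreal (c powr (p - 1)) * (indicator {0..} u * ennreal (u powr (p - 1) * exp (- (c * u))))"
    proof (cases "0 \<le> u")
      case True
      then have "(c * u) powr (p - 1) / exp (c * u) = c powr (p - 1) * (u powr (p - 1) * exp (- (c * u)))"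
        using assms by (simp add: powr_mult exp_minus divide_inverse)
      then show ?thesis
        using True assms by (simp add: ennreal_mult)
    next
      case False
      then show ?thesis using assms by (simp add: zero_le_mult_iff)
    qed
  qed
  also have "\<dots> = ennreal (c powr (p - 1)) * (\<integral>\<^sup>+u. indicator {0..} u * ennreal (u powr (p - 1) * exp (- (c * u))) \<partial>lborel)"
    by (intro nn_integral_cmult) auto
  finally have "ennreal c * (ennreal (c powr (p - 1)) *
      (\<integral>\<^sup>+u. indicator {0..} u * ennreal (u powr (p - 1) * exp (- (c * u))) \<partial>lborel)) < \<infinity>"
    by (metis ennreal_less_top infinity_ennreal_def)
  then show ?thesis
    using assms by (auto simp: ennreal_mult_less_top)
qed

text \<open>Subtraction in \<open>ennreal\<close> is truncated at \<open>0\<close>. Since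
  \<open>0 \<le> a\<close>, both sides are false whenever truncation occurs.\<close>

lemma ennreal_less_diff_iff:
  "0 \<le> a \<Longrightarrow> 0 \<le> u \<Longrightarrow> ennreal a < y - ennreal u \<longleftrightarrow> ennreal (u + a) < y"
  by (cases y) (auto simp: ennreal_minus ennreal_less_iff simp del: ennreal_plus)

section \<open>Inverse subordinators\<close>

text \<open>The assumption \<open>nonzero\<close> makes \<open>D\<close> leave every bounded level
  almost surely, so that its inverse is almost surely finite.\<close>

locale nonzero_subordinator = prob_space M for M :: "'w measure" +
  fixes D :: "real \<Rightarrow> 'w \<Rightarrow> real" and \<phi> :: "real \<Rightarrow> real"
  assumes subordinator: "subordinator M D \<phi>" and nonzero: "\<exists>l\<ge>0. \<phi> l \<noteq> 0"
begin

abbreviation Y :: "real \<Rightarrow> 'w \<Rightarrow> ennreal" where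
  "Y \<equiv> inverse_subordinator D"

section \<open>Paths and increments of the subordinator\<close>

lemma D_measurable [measurable]: "u \<ge> 0 \<Longrightarrow> D u \<in> borel_measurable M"
  using subordinator by (simp add: subordinator_def)

lemma D_zero: "\<omega> \<in> space M \<Longrightarrow> D 0 \<omega> = 0"
  using subordinator by (simp add: subordinator_def)

lemma D_mono: "\<omega> \<in> space M \<Longrightarrow> 0 \<le> u \<Longrightarrow> u \<le> v \<Longrightarrow> D u \<omega> \<le> D v \<omega>"
  using subordinator by (auto simp: subordinator_def monotone_on_def)

lemma D_nonneg: "\<omega> \<in> space M \<Longrightarrow> 0 \<le> u \<Longrightarrow> 0 \<le> D u \<omega>"
  using D_mono[of \<omega> 0 u] D_zero[of \<omega>] by simp

text \<open>Right continuity in the form needed for measurability: it leaves room for a rational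
  time between \<open>u\<close> and \<open>v\<close>.\<close>

lemma D_right_continuous:
  assumes "\<omega> \<in> space M" "0 \<le> u" "D u \<omega> < x"
  obtains v where "u < v" "D v \<omega> < x"
proof -
  have "((\<lambda>u. D u \<omega>) \<longlongrightarrow> D u \<omega>) (at_right u)"
    using subordinator assms(1,2) by (auto simp: subordinator_def continuous_within)
  then have "\<forall>\<^sub>F v in at_right u. D v \<omega> < x"
    using assms(3) by (rule order_tendstoD)
  then have "\<forall>\<^sub>F v in at_right u. u < v \<and> D v \<omega> < x"
    using eventually_at_right_less[of u] by (rule eventually_conj[rotated])
  then show thesis
    using that eventually_happens' trivial_limit_at_right_real by blast
qed

lemma D_increment_distr:
  "u \<ge> 0 \<Longrightarrow> h \<ge> 0 \<Longrightarrow> distr M borel (\<lambda>\<omega>. D (u + h) \<omega> - D u \<omega>) = distr M borel (D h)"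
  using subordinator by (simp add: subordinator_def)

lemma D_laplace: "u \<ge> 0 \<Longrightarrow> l \<ge> 0 \<Longrightarrow> (LINT \<omega>|M. exp (- l * D u \<omega>)) = exp (- u * \<phi> l)"
  using subordinator by (simp add: subordinator_def)

lemma D_indep_increments:
  assumes "0 \<le> w 0" "\<forall>i<n. w i \<le> w (Suc i)"
  shows "indep_vars (\<lambda>_. borel) (\<lambda>i \<omega>. D (w (Suc i)) \<omega> - D (w i) \<omega>) {..<n::nat}"
proof -
  have "\<forall>(n::nat) u. 0 \<le> u 0 \<and> (\<forall>i<n. u i \<le> u (Suc i)) \<longrightarrow>
      indep_vars (\<lambda>_. borel) (\<lambda>i \<omega>. D (u (Suc i)) \<omega> - D (u i) \<omega>) {..<n}"
    using subordinator unfolding subordinator_def by (elim conjE)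
  from this[rule_format, of w n] show ?thesis using assms by simp
qed

text \<open>The grid \<open>0, u, u + h\<close> has two independent increments; the first is
  \<open>D u\<close> because paths start at \<open>0\<close>, and stationarity gives the law of the
  second.\<close>

lemma D_pair_distr:
  assumes "u \<ge> 0" "h \<ge> 0"
  shows "distr M (borel \<Otimes>\<^sub>M borel) (\<lambda>\<omega>. (D u \<omega>, D (u + h) \<omega> - D u \<omega>)) =
         distr M borel (D u) \<Otimes>\<^sub>M distr M borel (D h)"
proof -
  define w :: "nat \<Rightarrow> real" where "w = (\<lambda>i. if i = 0 then 0 else if i = 1 then u else u + h)"
  define X where "X = (\<lambda>i \<omega>. D (w (Suc i)) \<omega> - D (w i) \<omega>)"
  have "indep_vars (\<lambda>_. borel) X {..<2}"
    unfolding X_def using assms by (intro D_indep_increments) (auto simp: w_def)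
  moreover have "{..<2::nat} = insert 0 {1}" by auto
  \<comment> \<open>A sum over one index turns independence of the family into independence of a
    pair.\<close>
  ultimately have "indep_var borel (X 0) borel (\<lambda>\<omega>. \<Sum>i\<in>{1}. X i \<omega>)"
    using indep_vars_sum[of "{1}" 0 X] by simp
  then have *: "indep_var borel (\<lambda>\<omega>. D u \<omega> - D 0 \<omega>) borel (\<lambda>\<omega>. D (u + h) \<omega> - D u \<omega>)"
    by (simp add: X_def w_def)
  have "distr M (borel \<Otimes>\<^sub>M borel) (\<lambda>\<omega>. (D u \<omega>, D (u + h) \<omega> - D u \<omega>)) =
        distr M (borel \<Otimes>\<^sub>M borel) (\<lambda>\<omega>. (D u \<omega> - D 0 \<omega>, D (u + h) \<omega> - D u \<omega>))"
    by (rule distr_cong) (simp_all add: D_zero)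
  also have "\<dots> = distr M borel (\<lambda>\<omega>. D u \<omega> - D 0 \<omega>) \<Otimes>\<^sub>M distr M borel (\<lambda>\<omega>. D (u + h) \<omega> - D u \<omega>)"
    using * by (simp add: indep_var_distribution_eq)
  also have "distr M borel (\<lambda>\<omega>. D u \<omega> - D 0 \<omega>) = distr M borel (D u)"
    by (rule distr_cong) (simp_all add: D_zero)
  also have "distr M borel (\<lambda>\<omega>. D (u + h) \<omega> - D u \<omega>) = distr M borel (D h)"
    by (intro D_increment_distr assms)
  finally show ?thesis .
qed

text \<open>By monotonicity and right continuity, \<open>D\<close> lies below \<open>x\<close> at a
  time exactly when it does so at some later rational time. The clamp \<open>max 0 u\<close> makes
  the map total, since \<open>D\<close> is constrained only at nonnegative times.\<close>

lemma D_joint_measurable [measurable]: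
  "(\<lambda>(u, \<omega>). D (max 0 u) \<omega>) \<in> borel_measurable (borel \<Otimes>\<^sub>M M)"
proof (rule borel_measurableI_less)
  fix x :: real
  have "{p \<in> space (borel \<Otimes>\<^sub>M M). (case p of (u, \<omega>) \<Rightarrow> D (max 0 u) \<omega>) < x} =
        (\<Union>q\<in>\<rat> \<inter> {0<..}. {..<q} \<times> {\<omega> \<in> space M. D q \<omega> < x})"
  proof safe
    fix u \<omega> assume *: "(u, \<omega>) \<in> space (borel \<Otimes>\<^sub>M M)" "D (max 0 u) \<omega> < x"
    then have \<omega>: "\<omega> \<in> space M" by (auto simp: space_pair_measure)
    obtain v where v: "max 0 u < v" "D v \<omega> < x"
      using D_right_continuous[OF \<omega> _ *(2)] by auto
    obtain q where q: "q \<in> \<rat>" "max 0 u < q" "q < v"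
      using Rats_dense_in_real[OF v(1)] by auto
    moreover have "D q \<omega> < x"
      using D_mono[OF \<omega>, of q v] q v by auto
    ultimately show "(u, \<omega>) \<in> (\<Union>q\<in>\<rat> \<inter> {0<..}. {..<q} \<times> {\<omega> \<in> space M. D q \<omega> < x})"
      using \<omega> by auto
  next
    fix u \<omega> and q :: real assume "u < q" "0 < q" "\<omega> \<in> space M" "D q \<omega> < x"
    then show "D (max 0 u) \<omega> < x"
      using D_mono[of \<omega> "max 0 u" q] by auto
  qed (auto simp: space_pair_measure)
  also have "\<dots> \<in> sets (borel \<Otimes>\<^sub>M M)"
    by (intro sets.countable_UN'' pair_measureI) (auto simp: countable_rat)
  finally show "{p \<in> space (borel \<Otimes>\<^sub>M M). (case p of (u, \<omega>) \<Rightarrow> D (max 0 u) \<omega>) < x} \<in> sets (borel \<Otimes>\<^sub>M M)" .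
qed

section \<open>First-passage times\<close>

lemma Y_less_iff: "Y x \<omega> < a \<longleftrightarrow> (\<exists>u\<ge>0. ennreal u < a \<and> x < D u \<omega>)"
  by (auto simp: inverse_subordinator_def INF_less_iff)

lemma Y_mono: "x \<le> y \<Longrightarrow> Y x \<omega> \<le> Y y \<omega>"
  unfolding inverse_subordinator_def by (rule INF_superset_mono) auto

lemma Y_neg: "x < 0 \<Longrightarrow> \<omega> \<in> space M \<Longrightarrow> Y x \<omega> = 0"
  using D_zero[of \<omega>] unfolding inverse_subordinator_def
  by (intro antisym INF_lower2[of 0]) auto

text \<open>By monotonicity of \<open>D\<close>, rational passage times suffice. Joint measurability
  is what later allows a random level \<open>t - D u\<close> to be inserted.\<close>

lemma Y_joint_measurable [measurable]: "(\<lambda>(x, \<omega>). Y x \<omega>) \<in> borel_measurable (borel \<Otimes>\<^sub>M M)"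
proof (rule borel_measurableI_less)
  fix a :: ennreal
  have "{p \<in> space (borel \<Otimes>\<^sub>M M). (case p of (x, \<omega>) \<Rightarrow> Y x \<omega>) < a} =
        (\<Union>q\<in>\<rat> \<inter> {q. 0 \<le> q \<and> ennreal q < a}. {p \<in> space (borel \<Otimes>\<^sub>M M). fst p < D q (snd p)})"
  proof safe
    fix x \<omega> assume *: "(x, \<omega>) \<in> space (borel \<Otimes>\<^sub>M M)" "Y x \<omega> < a"
    then have \<omega>: "\<omega> \<in> space M" by (auto simp: space_pair_measure)
    obtain u where u: "0 \<le> u" "ennreal u < a" "x < D u \<omega>"
      using * by (auto simp: Y_less_iff)
    obtain v where v: "u < v" "ennreal v < a"
      using ennreal_real_dense u(2,1) by blast
    then obtain q where q: "q \<in> \<rat>" "u < q" "q < v"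
      using Rats_dense_in_real[of u v] by auto
    moreover have "ennreal q < a"
      using ennreal_leI[of q v] q v(2) by auto
    moreover have "x < D q \<omega>"
      using D_mono[OF \<omega>, of u q] q u by auto
    ultimately show "(x, \<omega>) \<in> (\<Union>q\<in>\<rat> \<inter> {q. 0 \<le> q \<and> ennreal q < a}. {p \<in> space (borel \<Otimes>\<^sub>M M). fst p < D q (snd p)})"
      using *(1) u(1) by auto
  qed (auto simp: Y_less_iff)
  also have "\<dots> \<in> sets (borel \<Otimes>\<^sub>M M)"
    by (intro sets.countable_UN'') (auto simp: countable_rat)
  finally show "{p \<in> space (borel \<Otimes>\<^sub>M M). (case p of (x, \<omega>) \<Rightarrow> Y x \<omega>) < a} \<in> sets (borel \<Otimes>\<^sub>M M)" .
qed

lemma Y_measurable [measurable]: "Y x \<in> borel_measurable M"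
  using measurable_compose[OF measurable_Pair1'[of x borel M] Y_joint_measurable] by simp

text \<open>With \<open>D_le_if_less_Y\<close>, this makes \<open>D u \<le> x\<close> and
  \<open>u < Y x\<close> equivalent except at the single time \<open>u = Y x\<close>.\<close>

lemma le_Y_if_D_le:
  assumes "\<omega> \<in> space M" "0 \<le> u" "D u \<omega> \<le> x"
  shows "ennreal u \<le> Y x \<omega>"
proof (rule ccontr)
  assume "\<not> ennreal u \<le> Y x \<omega>"
  then obtain v where v: "0 \<le> v" "ennreal v < ennreal u" "x < D v \<omega>"
    by (auto simp: Y_less_iff not_le)
  then show False
    using D_mono[OF assms(1), of v u] assms by (auto simp: ennreal_less_iff)
qed

lemma D_le_if_less_Y:
  assumes "0 \<le> u" "ennreal u < Y x \<omega>"
  shows "D u \<omega> \<le> x"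
proof (rule ccontr)
  assume "\<not> D u \<omega> \<le> x"
  then have "Y x \<omega> \<le> ennreal u"
    using assms(1) unfolding inverse_subordinator_def by (intro INF_lower) auto
  with assms(2) show False by (simp add: leD)
qed

text \<open>Expresses the strict tail exactly, with no exceptional time, through countably many
  values of \<open>D\<close>. The extra \<open>1 / Suc n\<close> matters: \<open>D a \<le> x\<close>
  alone gives only \<open>a \<le> Y x\<close>.\<close>

lemma less_Y_iff:
  assumes "\<omega> \<in> space M" "0 \<le> a"
  shows "ennreal a < Y x \<omega> \<longleftrightarrow> (\<exists>n. D (a + 1 / Suc n) \<omega> \<le> x)"
proof
  assume "ennreal a < Y x \<omega>"
  then obtain v where v: "a < v" "ennreal v < Y x \<omega>"
    using ennreal_real_dense assms(2) by blast
  then obtain n where n: "1 / Suc n < v - a"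
    using reals_Archimedean[of "v - a"] by (auto simp: inverse_eq_divide)
  have "D v \<omega> \<le> x"
    using v(2) assms(2) v(1) by (intro D_le_if_less_Y) auto
  moreover have "D (a + 1 / Suc n) \<omega> \<le> D v \<omega>"
    using n assms by (intro D_mono) auto
  ultimately show "\<exists>n. D (a + 1 / Suc n) \<omega> \<le> x" by (meson order_trans)
next
  assume "\<exists>n. D (a + 1 / Suc n) \<omega> \<le> x"
  then obtain n where "D (a + 1 / Suc n) \<omega> \<le> x" ..
  then have "ennreal (a + 1 / Suc n) \<le> Y x \<omega>"
    using assms by (intro le_Y_if_D_le) auto
  moreover have "ennreal a < ennreal (a + 1 / Suc n)"
    using assms by (simp add: ennreal_less_iff)
  ultimately show "ennreal a < Y x \<omega>" by (rule order.strict_trans2[rotated])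
qed

text \<open>Exponential Markov inequality for \<open>exp (- l * D u)\<close>, with
  \<open>c = \<phi> l\<close>. The constants depend on neither \<open>u\<close> nor
  \<open>x\<close>.\<close>

lemma D_tail_bound:
  obtains l c where "0 \<le> l" "0 < c" "\<And>u x. 0 \<le> u \<Longrightarrow> emeasure M {\<omega>\<in>space M. D u \<omega> \<le> x} \<le> ennreal (exp (l * x) * exp (- (c * u)))"
proof -
  obtain l where l: "0 \<le> l" "\<phi> l \<noteq> 0" using nonzero by blast
  have int: "integrable M (\<lambda>\<omega>. exp (- l * D u \<omega>))" if "u \<ge> 0" for u
    using that l by (intro integrable_const_bound[where B = 1]) (auto intro!: AE_I2 mult_nonneg_nonneg D_nonneg)
  have "(LINT \<omega>|M. exp (- l * D 1 \<omega>)) \<le> (LINT \<omega>|M. 1)"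
    using l by (intro integral_mono int) (auto intro!: mult_nonneg_nonneg D_nonneg)
  \<comment> \<open>At time \<open>1\<close> the Laplace transform reads
    \<open>exp (- \<phi> l) \<le> 1\<close>, so \<open>\<phi> l\<close> is nonnegative, and it is
    nonzero by choice of \<open>l\<close>.\<close>
  then have "0 < \<phi> l"
    using l D_laplace[of 1 l] by (auto simp: prob_space)
  moreover have "emeasure M {\<omega>\<in>space M. D u \<omega> \<le> x} \<le> ennreal (exp (l * x) * exp (- (\<phi> l * u)))" if u: "0 \<le> u" for u x
  proof -
    note [measurable] = D_measurable[OF u]
    have "emeasure M {\<omega>\<in>space M. D u \<omega> \<le> x} = (\<integral>\<^sup>+\<omega>. indicator {\<omega>\<in>space M. D u \<omega> \<le> x} \<omega> \<partial>M)"
      by (subst nn_integral_indicator) simp_all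
    also have "\<dots> \<le> (\<integral>\<^sup>+\<omega>. ennreal (exp (l * x) * exp (- l * D u \<omega>)) \<partial>M)"
    proof (intro nn_integral_mono)
      fix \<omega>
      have "1 \<le> exp (l * x) * exp (- l * D u \<omega>)" if "D u \<omega> \<le> x"
        using mult_left_mono[OF that l(1)] by (simp flip: exp_add)
      then show "indicator {\<omega>\<in>space M. D u \<omega> \<le> x} \<omega> \<le> ennreal (exp (l * x) * exp (- l * D u \<omega>))"
        by (simp split: split_indicator)
    qed
    also have "\<dots> = ennreal (LINT \<omega>|M. exp (l * x) * exp (- l * D u \<omega>))"
      by (intro nn_integral_eq_integral integrable_mult_right int u) auto
    also have "\<dots> = ennreal (exp (l * x) * exp (- (\<phi> l * u)))"
      using D_laplace[OF u l(1)] by (simp add: mult.commute)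
    finally show ?thesis .
  qed
  ultimately show thesis by (rule that[OF l(1)])
qed

text \<open>On \<open>Y x = top\<close> every \<open>D (real n)\<close> stays at most
  \<open>x\<close>; the tail bound tends to \<open>0\<close> as \<open>n\<close> grows.\<close>

lemma AE_Y_finite: "AE \<omega> in M. Y x \<omega> < top"
proof -
  obtain l c where lc: "0 \<le> l" "0 < c"
    "\<And>u x. 0 \<le> u \<Longrightarrow> emeasure M {\<omega>\<in>space M. D u \<omega> \<le> x} \<le> ennreal (exp (l * x) * exp (- (c * u)))"
    using D_tail_bound by metis
  have "emeasure M {\<omega>\<in>space M. Y x \<omega> = top} \<le> ennreal (exp (l * x) * exp (- (c * real n)))" for n
  proof -
    have "emeasure M {\<omega>\<in>space M. Y x \<omega> = top} \<le> emeasure M {\<omega>\<in>space M. D (real n) \<omega> \<le> x}"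
      by (intro emeasure_mono) (auto intro!: D_le_if_less_Y)
    also have "\<dots> \<le> ennreal (exp (l * x) * exp (- (c * real n)))"
      by (intro lc) simp
    finally show ?thesis .
  qed
  moreover have "(\<lambda>n. ennreal (exp (l * x) * exp (- (c * real n)))) \<longlonglongrightarrow> ennreal 0"
    using lc(2) by (intro tendsto_ennrealI) real_asymp
  ultimately have "emeasure M {\<omega>\<in>space M. Y x \<omega> = top} \<le> ennreal 0"
    by (intro LIMSEQ_le_const) auto
  then have "emeasure M {\<omega>\<in>space M. Y x \<omega> = top} = 0" by simp
  then have "AE \<omega> in M. Y x \<omega> \<noteq> top"
    by (subst AE_iff_measurable[OF _ refl]) auto
  then show ?thesis by (simp add: less_top)
qed

lemma AE_D_le_iff_less_Y:
  assumes "\<omega> \<in> space M" "Y x \<omega> < top"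
  shows "AE u in lborel. 0 \<le> u \<longrightarrow> (D (max 0 u) \<omega> \<le> x \<longleftrightarrow> u < enn2real (Y x \<omega>))"
  using AE_lborel_singleton[of "enn2real (Y x \<omega>)"]
proof eventually_elim
  case (elim u)
  obtain y where y: "Y x \<omega> = ennreal y" "0 \<le> y"
    using assms(2) by (cases "Y x \<omega>") auto
  have "u \<le> y" if "0 \<le> u" "D u \<omega> \<le> x"
    using le_Y_if_D_le[OF assms(1) that] that y by simp
  moreover have "D u \<omega> \<le> x" if "0 \<le> u" "u < y"
    using that y by (intro D_le_if_less_Y) (simp_all add: ennreal_less_iff)
  ultimately show ?case
    using elim y by (auto simp: max_def)
qed

section \<open>Occupation measure and moments of the inverse\<close>

lemma nn_integral_D_le:
  assumes [measurable]: "f \<in> borel_measurable borel" and "\<omega> \<in> space M" "Y x \<omega> < top"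
  shows "(\<integral>\<^sup>+u. indicator {0..} u * (indicator {..x} (D (max 0 u) \<omega>) * f u) \<partial>lborel) =
         (\<integral>\<^sup>+u. indicator {0..<enn2real (Y x \<omega>)} u * f u \<partial>lborel)"
  using AE_D_le_iff_less_Y[OF assms(2,3)]
  by (intro nn_integral_cong_AE) (auto elim!: eventually_mono split: split_indicator)

text \<open>The potential measure of \<open>D\<close>: the mass of a Borel set is the expected
  Lebesgue time that \<open>D\<close> spends in it.\<close>

definition occupation_measure :: "real measure" where
  "occupation_measure =
     distr (density lborel (indicator {0..}) \<Otimes>\<^sub>M M) borel (\<lambda>(u, \<omega>). D (max 0 u) \<omega>)"

lemma sets_occupation_measure [simp, measurable_cong]: "sets occupation_measure = sets borel"
  by (simp add: occupation_measure_def)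

lemma nn_integral_occupation_measure:
  assumes [measurable]: "f \<in> borel_measurable borel"
  shows "(\<integral>\<^sup>+y. f y \<partial>occupation_measure) =
    (\<integral>\<^sup>+u. indicator {0..} u * (\<integral>\<^sup>+\<omega>. f (D (max 0 u) \<omega>) \<partial>M) \<partial>lborel)"
proof -
  have [measurable]: "(\<lambda>(u, \<omega>). D (max 0 u) \<omega>) \<in> borel_measurable (density lborel (indicator {0..}) \<Otimes>\<^sub>M M)"
    using D_joint_measurable by (simp cong: measurable_cong_sets sets_pair_measure_cong)
  have "(\<integral>\<^sup>+y. f y \<partial>occupation_measure) =
    (\<integral>\<^sup>+p. f (case p of (u, \<omega>) \<Rightarrow> D (max 0 u) \<omega>) \<partial>(density lborel (indicator {0..}) \<Otimes>\<^sub>M M))"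
    unfolding occupation_measure_def by (subst nn_integral_distr) auto
  also have "\<dots> = (\<integral>\<^sup>+u. \<integral>\<^sup>+\<omega>. f (D (max 0 u) \<omega>) \<partial>M \<partial>density lborel (indicator {0..}))"
    by (subst nn_integral_fst[symmetric]) simp_all
  also have "\<dots> = (\<integral>\<^sup>+u. indicator {0..} u * (\<integral>\<^sup>+\<omega>. f (D (max 0 u) \<omega>) \<partial>M) \<partial>lborel)"
    using D_joint_measurable by (subst nn_integral_density) (auto intro!: borel_measurable_nn_integral)
  finally show ?thesis .
qed

lemma lborel_M_Fubini:
  assumes "case_prod f \<in> borel_measurable (lborel \<Otimes>\<^sub>M M)"
  shows "(\<integral>\<^sup>+\<omega>. \<integral>\<^sup>+u. f u \<omega> \<partial>lborel \<partial>M) = (\<integral>\<^sup>+u. \<integral>\<^sup>+\<omega>. f u \<omega> \<partial>M \<partial>lborel)"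
proof -
  interpret P: pair_sigma_finite lborel M ..
  show ?thesis using assms by (rule P.Fubini')
qed

lemma D_joint_measurable' [measurable]:
  "(\<lambda>(u, \<omega>). D (max 0 u) \<omega>) \<in> borel_measurable (lborel \<Otimes>\<^sub>M M)"
  using D_joint_measurable by (simp cong: measurable_cong_sets sets_pair_measure_cong)

text \<open>By Tonelli, the mass is the expected length of the set of times with
  \<open>D u \<le> x\<close>, and that length is almost surely \<open>Y x\<close>.\<close>

lemma occupation_measure_atMost: "emeasure occupation_measure {..x} = inv_moment M Y 1 x"
proof -
  have "emeasure occupation_measure {..x} = (\<integral>\<^sup>+y. indicator {..x} y \<partial>occupation_measure)"
    by simp
  also have "\<dots> = (\<integral>\<^sup>+u. \<integral>\<^sup>+\<omega>. indicator {0..} u * indicator {..x} (D (max 0 u) \<omega>) \<partial>M \<partial>lborel)"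
    by (subst nn_integral_occupation_measure) (auto intro!: nn_integral_cong split: split_indicator)
  also have "\<dots> = (\<integral>\<^sup>+\<omega>. \<integral>\<^sup>+u. indicator {0..} u * indicator {..x} (D (max 0 u) \<omega>) \<partial>lborel \<partial>M)"
    by (subst lborel_M_Fubini) simp_all
  also have "\<dots> = (\<integral>\<^sup>+\<omega>. Y x \<omega> \<partial>M)"
  proof (rule nn_integral_cong_AE)
    show "AE \<omega> in M. (\<integral>\<^sup>+u. indicator {0..} u * indicator {..x} (D (max 0 u) \<omega>) \<partial>lborel) = Y x \<omega>"
      using AE_Y_finite[of x] AE_space
    proof eventually_elim
      case (elim \<omega>)
      then show ?case
        using nn_integral_D_le[of "\<lambda>_. 1" \<omega> x] by simp
    qed
  qed
  finally show ?thesis by (simp add: inv_moment_def ennpowr_one)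
qed

text \<open>Almost surely, the power \<open>p\<close> of \<open>Y x\<close> is the integral of
  \<open>p * u powr (p - 1)\<close> over the times with \<open>D u \<le> x\<close>. Tonelli and the
  exponential tail bound leave a convergent Gamma integral.\<close>

lemma inv_moment_finite:
  assumes p: "0 < p"
  shows "inv_moment M Y p x < top"
proof -
  obtain l c where lc: "0 \<le> l" "0 < c"
    "\<And>u x. 0 \<le> u \<Longrightarrow> emeasure M {\<omega>\<in>space M. D u \<omega> \<le> x} \<le> ennreal (exp (l * x) * exp (- (c * u)))"
    using D_tail_bound by metis
  let ?f = "\<lambda>u. ennreal (u powr (p - 1))"
  have "inv_moment M Y p x = (\<integral>\<^sup>+\<omega>. ennreal p * (\<integral>\<^sup>+u. indicator {0..} u * (indicator {..x} (D (max 0 u) \<omega>) * ?f u) \<partial>lborel) \<partial>M)"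
    unfolding inv_moment_def
  proof (rule nn_integral_cong_AE)
    show "AE \<omega> in M. ennpowr (Y x \<omega>) p = ennreal p * (\<integral>\<^sup>+u. indicator {0..} u * (indicator {..x} (D (max 0 u) \<omega>) * ?f u) \<partial>lborel)"
      using AE_Y_finite[of x] AE_space
    proof eventually_elim
      case (elim \<omega>)
      then obtain y where y: "Y x \<omega> = ennreal y" "0 \<le> y" by (cases "Y x \<omega>") auto
      have "(\<integral>\<^sup>+u. indicator {0..<y} u * ?f u \<partial>lborel) = (\<integral>\<^sup>+u. indicator {0..y} u * ?f u \<partial>lborel)"
        using AE_lborel_singleton[of y]
        by (intro nn_integral_cong_AE) (auto elim!: eventually_mono split: split_indicator)
      then show ?case
        using nn_integral_D_le[of ?f \<omega> x] elim y nn_integral_powr[OF p y(2)] p by (simp add: ennpowr_nonneg)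
    qed
  qed
  also have "\<dots> = ennreal p * (\<integral>\<^sup>+\<omega>. \<integral>\<^sup>+u. indicator {0..} u * (indicator {..x} (D (max 0 u) \<omega>) * ?f u) \<partial>lborel \<partial>M)"
    by (intro nn_integral_cmult) measurable
  also have "(\<integral>\<^sup>+\<omega>. \<integral>\<^sup>+u. indicator {0..} u * (indicator {..x} (D (max 0 u) \<omega>) * ?f u) \<partial>lborel \<partial>M) =
     (\<integral>\<^sup>+u. \<integral>\<^sup>+\<omega>. indicator {0..} u * (indicator {..x} (D (max 0 u) \<omega>) * ?f u) \<partial>M \<partial>lborel)"
    by (intro lborel_M_Fubini) measurable
  also have "\<dots> \<le> (\<integral>\<^sup>+u. ennreal (exp (l * x)) * (indicator {0..} u * ennreal (u powr (p - 1) * exp (- (c * u)))) \<partial>lborel)"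
  proof (intro nn_integral_mono)
    fix u
    show "(\<integral>\<^sup>+\<omega>. indicator {0..} u * (indicator {..x} (D (max 0 u) \<omega>) * ?f u) \<partial>M) \<le>
      ennreal (exp (l * x)) * (indicator {0..} u * ennreal (u powr (p - 1) * exp (- (c * u))))"
    proof (cases "0 \<le> u")
      case True
      have "(\<integral>\<^sup>+\<omega>. indicator {0..} u * (indicator {..x} (D (max 0 u) \<omega>) * ?f u) \<partial>M) =
        (\<integral>\<^sup>+\<omega>. ?f u * indicator {\<omega>\<in>space M. D u \<omega> \<le> x} \<omega> \<partial>M)"
        using True by (intro nn_integral_cong) (auto split: split_indicator)
      also have "\<dots> = ?f u * emeasure M {\<omega>\<in>space M. D u \<omega> \<le> x}"
        using True by (intro nn_integral_cmult_indicator) measurable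
      also have "\<dots> \<le> ?f u * ennreal (exp (l * x) * exp (- (c * u)))"
        by (intro mult_left_mono lc True) simp
      finally show ?thesis
        using True by (simp add: ennreal_mult mult_ac)
    qed simp
  qed
  also have "\<dots> = ennreal (exp (l * x)) * (\<integral>\<^sup>+u. indicator {0..} u * ennreal (u powr (p - 1) * exp (- (c * u))) \<partial>lborel)"
    by (intro nn_integral_cmult) measurable
  finally have "inv_moment M Y p x \<le> ennreal p * (ennreal (exp (l * x)) * (\<integral>\<^sup>+u. indicator {0..} u * ennreal (u powr (p - 1) * exp (- (c * u))) \<partial>lborel))"
    by (simp add: mult_left_mono)
  also have "\<dots> < top"
    using nn_integral_powr_exp_finite[OF p lc(2)] by (simp add: ennreal_mult_less_top)
  finally show ?thesis .
qed

text \<open>The distribution functions agree; below \<open>0\<close> both vanish by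
  \<open>Y_neg\<close>. The atom \<open>U 0\<close> is the expected time that \<open>D\<close>
  spends at \<open>0\<close>.\<close>

lemma renewal_measure_eq_occupation: "renewal_measure M Y = occupation_measure"
  unfolding renewal_measure_def
proof (rule interval_measure_eqI)
  fix x
  show "emeasure occupation_measure {..x} = ennreal (if x < 0 then 0 else enn2real (inv_moment M Y 1 x))"
  proof (cases "x < 0")
    case True
    then have "inv_moment M Y 1 x = (\<integral>\<^sup>+\<omega>. 0 \<partial>M)"
      unfolding inv_moment_def by (intro nn_integral_cong) (simp add: Y_neg ennpowr_one)
    then show ?thesis using True by (simp add: occupation_measure_atMost)
  next
    case False
    then show ?thesis
      using inv_moment_finite[of 1 x] by (simp add: occupation_measure_atMost)
  qed
qed simp_all

section \<open>The Markov property at a fixed time\<close>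

lemma Y_random_level_measurable [measurable]:
  "u \<ge> 0 \<Longrightarrow> (\<lambda>(\<omega>, \<omega>'). Y (t - D u \<omega>) \<omega>') \<in> borel_measurable (M \<Otimes>\<^sub>M M)"
proof -
  assume [measurable]: "u \<ge> 0"
  \<comment> \<open>The first outcome determines the level; the second drives an independent copy of
    the subordinator restarted at \<open>0\<close>.\<close>
  have "(\<lambda>p. (t - D u (fst p), snd p)) \<in> M \<Otimes>\<^sub>M M \<rightarrow>\<^sub>M borel \<Otimes>\<^sub>M M"
    by measurable
  from measurable_compose[OF this Y_joint_measurable]
  show ?thesis by (simp add: case_prod_beta')
qed

text \<open>Only the independence of \<open>D u\<close> and the single increment \<open>D (u + q) - D u\<close> is needed, because
  \<open>Y t > u + a\<close> is the increasing union of the events \<open>D (u + q) \<le> t\<close> along \<open>q\<close> decreasing to \<open>a\<close>.\<close>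

lemma Markov_tail:
  assumes u: "0 \<le> u" and a: "0 \<le> a"
  shows "emeasure M {\<omega>\<in>space M. D u \<omega> \<le> s \<and> ennreal (u + a) < Y t \<omega>} =
    emeasure (M \<Otimes>\<^sub>M M) {p\<in>space (M \<Otimes>\<^sub>M M). D u (fst p) \<le> s \<and> ennreal a < Y (t - D u (fst p)) (snd p)}"
proof -
  note [measurable] = D_measurable[OF u]
  define q where "q = (\<lambda>n. a + 1 / real (Suc n))"
  have q: "0 \<le> q n" for n using a by (simp add: q_def)
  have q_mono: "q n \<le> q m" if "m \<le> n" for m n using that by (simp add: q_def frac_le)
  note [measurable] = D_measurable[OF q]
  \<comment> \<open>The event \<open>D u \<le> s\<close>, \<open>D (u + q n) \<le> t\<close> as a
    condition on the value at \<open>u\<close> and the increment after \<open>u\<close>.\<close>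
  define A where "A = {p. fst p \<le> s \<and> fst p + snd p \<le> (t::real)}"
  have "{p \<in> space (borel \<Otimes>\<^sub>M borel). fst p \<le> s \<and> fst p + snd p \<le> t} \<in> sets (borel \<Otimes>\<^sub>M borel)"
    by measurable
  then have A: "A \<in> sets (borel \<Otimes>\<^sub>M borel)"
    by (simp add: A_def space_pair_measure)
  have [measurable]: "D (u + q n) \<in> borel_measurable M" for n
    using u q[of n] by simp
  have step: "emeasure M {\<omega>\<in>space M. D u \<omega> \<le> s \<and> D (u + q n) \<omega> \<le> t} =
    emeasure (M \<Otimes>\<^sub>M M) {p\<in>space (M \<Otimes>\<^sub>M M). D u (fst p) \<le> s \<and> D (q n) (snd p) \<le> t - D u (fst p)}" for n
  proof -
    have "emeasure M {\<omega>\<in>space M. D u \<omega> \<le> s \<and> D (u + q n) \<omega> \<le> t} =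
      emeasure (distr M (borel \<Otimes>\<^sub>M borel) (\<lambda>\<omega>. (D u \<omega>, D (u + q n) \<omega> - D u \<omega>))) A"
      using A by (subst emeasure_distr) (auto simp: A_def intro!: arg_cong[where f = "emeasure M"])
    \<comment> \<open>The product law is realised on two copies of \<open>M\<close>, with
      \<open>D (q n)\<close> of the second outcome replacing the increment.\<close>
    also have "distr M (borel \<Otimes>\<^sub>M borel) (\<lambda>\<omega>. (D u \<omega>, D (u + q n) \<omega> - D u \<omega>)) =
      distr (M \<Otimes>\<^sub>M M) (borel \<Otimes>\<^sub>M borel) (\<lambda>(\<omega>, \<omega>'). (D u \<omega>, D (q n) \<omega>'))"
      unfolding D_pair_distr[OF u q] using q
      by (intro pair_measure_distr prob_space_imp_sigma_finite prob_space_distr) simp_all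
    also have "emeasure \<dots> A = emeasure (M \<Otimes>\<^sub>M M) {p\<in>space (M \<Otimes>\<^sub>M M). D u (fst p) \<le> s \<and> D (q n) (snd p) \<le> t - D u (fst p)}"
      using A by (subst emeasure_distr) (auto simp: A_def intro!: arg_cong[where f = "emeasure (M \<Otimes>\<^sub>M M)"])
    finally show ?thesis .
  qed
  have "emeasure M {\<omega>\<in>space M. D u \<omega> \<le> s \<and> ennreal (u + a) < Y t \<omega>} =
    emeasure M (\<Union>n. {\<omega>\<in>space M. D u \<omega> \<le> s \<and> D (u + q n) \<omega> \<le> t})"
    using less_Y_iff[of _ "u + a" t] a u by (intro arg_cong[where f = "emeasure M"]) (auto simp: q_def add.assoc)
  also have "\<dots> = (SUP n. emeasure M {\<omega>\<in>space M. D u \<omega> \<le> s \<and> D (u + q n) \<omega> \<le> t})"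
  proof (rule SUP_emeasure_incseq[symmetric])
    show "incseq (\<lambda>n. {\<omega>\<in>space M. D u \<omega> \<le> s \<and> D (u + q n) \<omega> \<le> t})"
    proof (rule incseq_SucI, safe)
      fix n \<omega> assume "\<omega> \<in> space M" "D (u + q n) \<omega> \<le> t"
      then show "D (u + q (Suc n)) \<omega> \<le> t"
        using D_mono[of \<omega> "u + q (Suc n)" "u + q n"] q_mono[of n "Suc n"] q[of "Suc n"] u by simp
    qed
  qed auto
  also have "\<dots> = (SUP n. emeasure (M \<Otimes>\<^sub>M M) {p\<in>space (M \<Otimes>\<^sub>M M). D u (fst p) \<le> s \<and> D (q n) (snd p) \<le> t - D u (fst p)})"
    by (simp only: step)
  also have "\<dots> = emeasure (M \<Otimes>\<^sub>M M) (\<Union>n. {p\<in>space (M \<Otimes>\<^sub>M M). D u (fst p) \<le> s \<and> D (q n) (snd p) \<le> t - D u (fst p)})"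
  proof (rule SUP_emeasure_incseq)
    show "incseq (\<lambda>n. {p\<in>space (M \<Otimes>\<^sub>M M). D u (fst p) \<le> s \<and> D (q n) (snd p) \<le> t - D u (fst p)})"
    proof (rule incseq_SucI, rule subsetI)
      fix n p assume "p \<in> {p\<in>space (M \<Otimes>\<^sub>M M). D u (fst p) \<le> s \<and> D (q n) (snd p) \<le> t - D u (fst p)}"
      moreover from this have "snd p \<in> space M" by (auto simp: space_pair_measure)
      then have "D (q (Suc n)) (snd p) \<le> D (q n) (snd p)"
        using D_mono q_mono[of n "Suc n"] q[of "Suc n"] by simp
      ultimately show "p \<in> {p\<in>space (M \<Otimes>\<^sub>M M). D u (fst p) \<le> s \<and> D (q (Suc n)) (snd p) \<le> t - D u (fst p)}"
        by auto
    qed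
  qed auto
  \<comment> \<open>\<open>less_Y_iff\<close> is used in reverse here, at time \<open>a\<close> and
    at the level left over after \<open>D u\<close>.\<close>
  also have "(\<Union>n. {p\<in>space (M \<Otimes>\<^sub>M M). D u (fst p) \<le> s \<and> D (q n) (snd p) \<le> t - D u (fst p)}) =
    {p\<in>space (M \<Otimes>\<^sub>M M). D u (fst p) \<le> s \<and> ennreal a < Y (t - D u (fst p)) (snd p)}"
    using less_Y_iff[of _ a] a by (auto simp: q_def space_pair_measure)
  finally show ?thesis .
qed

text \<open>\<open>Markov_tail\<close> identifies two finite measures on
  \<open>[0, \<infinity>]\<close> through their upper rays, and \<open>g\<close> is then integrated
  against both. If \<open>D u > t\<close>, the truncated difference and \<open>Y\<close> at the
  negative level are both \<open>0\<close>.\<close>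

lemma Markov_property:
  assumes u: "0 \<le> u" and g [measurable]: "g \<in> borel_measurable borel"
  shows "(\<integral>\<^sup>+\<omega>. indicator {..s} (D u \<omega>) * g (Y t \<omega> - ennreal u) \<partial>M) =
    (\<integral>\<^sup>+\<omega>. indicator {..s} (D u \<omega>) * (\<integral>\<^sup>+\<omega>'. g (Y (t - D u \<omega>) \<omega>') \<partial>M) \<partial>M)"
proof -
  note [measurable] = D_measurable[OF u] Y_random_level_measurable[OF u]
  \<comment> \<open>The densities restrict to \<open>D u \<le> s\<close>, so these are
    sub-probability laws of the residual time and of its restarted version.\<close>
  define N1 where "N1 = distr (density M (\<lambda>\<omega>. indicator {..s} (D u \<omega>))) borel (\<lambda>\<omega>. Y t \<omega> - ennreal u)"
  define N2 where "N2 = distr (density (M \<Otimes>\<^sub>M M) (\<lambda>p. indicator {..s} (D u (fst p)))) borel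
    (\<lambda>(\<omega>, \<omega>'). Y (t - D u \<omega>) \<omega>')"
  have N1: "emeasure N1 A = emeasure M {\<omega>\<in>space M. D u \<omega> \<le> s \<and> Y t \<omega> - ennreal u \<in> A}"
    if [measurable]: "A \<in> sets borel" for A
  proof -
    have "emeasure N1 A = (\<integral>\<^sup>+\<omega>. indicator {..s} (D u \<omega>) * indicator ((\<lambda>\<omega>. Y t \<omega> - ennreal u) -` A \<inter> space M) \<omega> \<partial>M)"
      unfolding N1_def by (simp add: emeasure_distr emeasure_density)
    also have "\<dots> = (\<integral>\<^sup>+\<omega>. indicator {\<omega>\<in>space M. D u \<omega> \<le> s \<and> Y t \<omega> - ennreal u \<in> A} \<omega> \<partial>M)"
      by (intro nn_integral_cong) (auto split: split_indicator)
    finally show ?thesis by simp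
  qed
  have N2: "emeasure N2 A = emeasure (M \<Otimes>\<^sub>M M) {p\<in>space (M \<Otimes>\<^sub>M M). D u (fst p) \<le> s \<and> Y (t - D u (fst p)) (snd p) \<in> A}"
    if [measurable]: "A \<in> sets borel" for A
  proof -
    have "emeasure N2 A = (\<integral>\<^sup>+p. indicator {..s} (D u (fst p)) * indicator ((\<lambda>(\<omega>, \<omega>'). Y (t - D u \<omega>) \<omega>') -` A \<inter> space (M \<Otimes>\<^sub>M M)) p \<partial>(M \<Otimes>\<^sub>M M))"
      unfolding N2_def by (simp add: emeasure_distr emeasure_density)
    also have "\<dots> = (\<integral>\<^sup>+p. indicator {p\<in>space (M \<Otimes>\<^sub>M M). D u (fst p) \<le> s \<and> Y (t - D u (fst p)) (snd p) \<in> A} p \<partial>(M \<Otimes>\<^sub>M M))"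
      by (intro nn_integral_cong) (auto split: split_indicator)
    finally show ?thesis by (simp add: case_prod_beta')
  qed
  have "N1 = N2"
  proof (rule measure_ennreal_eqI)
    have "emeasure N1 UNIV = emeasure M {\<omega>\<in>space M. D u \<omega> \<le> s}"
      by (subst N1) simp_all
    also have "\<dots> = emeasure (M \<Otimes>\<^sub>M M) ({\<omega>\<in>space M. D u \<omega> \<le> s} \<times> space M)"
      by (subst emeasure_pair_measure_Times) (simp_all add: emeasure_space_1)
    also have "\<dots> = emeasure N2 UNIV"
      by (subst N2) (auto simp: space_pair_measure intro!: arg_cong[where f = "emeasure (M \<Otimes>\<^sub>M M)"])
    finally show "emeasure N1 UNIV = emeasure N2 UNIV" .
    show "emeasure N1 UNIV \<noteq> \<infinity>"
      by (subst N1) simp_all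
    show "emeasure N1 {ennreal a<..} = emeasure N2 {ennreal a<..}" if a: "0 \<le> a" for a
      using Markov_tail[OF u a, of s t] by (simp add: N1 N2 ennreal_less_diff_iff a u)
  qed (simp_all add: N1_def N2_def)
  have "(\<integral>\<^sup>+\<omega>. indicator {..s} (D u \<omega>) * g (Y t \<omega> - ennreal u) \<partial>M) = (\<integral>\<^sup>+y. g y \<partial>N1)"
    unfolding N1_def by (simp add: nn_integral_distr nn_integral_density)
  also have "\<dots> = (\<integral>\<^sup>+p. indicator {..s} (D u (fst p)) * g (Y (t - D u (fst p)) (snd p)) \<partial>(M \<Otimes>\<^sub>M M))"
    unfolding \<open>N1 = N2\<close> N2_def by (simp add: nn_integral_distr nn_integral_density case_prod_beta')
  also have "\<dots> = (\<integral>\<^sup>+\<omega>. \<integral>\<^sup>+\<omega>'. indicator {..s} (D u \<omega>) * g (Y (t - D u \<omega>) \<omega>') \<partial>M \<partial>M)"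
    by (subst nn_integral_fst[symmetric]) simp_all
  also have "\<dots> = (\<integral>\<^sup>+\<omega>. indicator {..s} (D u \<omega>) * (\<integral>\<^sup>+\<omega>'. g (Y (t - D u \<omega>) \<omega>') \<partial>M) \<partial>M)"
    by (intro nn_integral_cong nn_integral_cmult) measurable
  finally show ?thesis .
qed

lemma inv_moment_measurable [measurable]: "(\<lambda>x. inv_moment M Y \<gamma> x) \<in> borel_measurable borel"
  unfolding inv_moment_def by measurable

text \<open>The expectation of \<open>nn_integral_reflected_powr\<close> with \<open>b = Y t\<close>
  and \<open>a = Y s\<close>. The additive form avoids subtraction in \<open>ennreal\<close>, where
  the moment of order \<open>p - 1\<close> may be infinite.\<close>

lemma moment_identity:
  assumes p: "0 < p" and st: "s \<le> t"
  shows "inv_moment M Y p t = (\<integral>\<^sup>+\<omega>. ennreal ((enn2real (Y t \<omega>) - enn2real (Y s \<omega>)) powr p) \<partial>M) +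
    ennreal p * (\<integral>\<^sup>+y\<in>{0..s}. inv_moment M Y (p - 1) (t - y) \<partial>renewal_measure M Y)"
proof -
  let ?h = "\<lambda>u \<omega>. indicator {0..} u * (indicator {..s} (D (max 0 u) \<omega>) * ennpowr (Y t \<omega> - ennreal u) (p - 1))"
  have h: "case_prod ?h \<in> borel_measurable (lborel \<Otimes>\<^sub>M M)"
    by measurable
  have "inv_moment M Y p t = (\<integral>\<^sup>+\<omega>. ennreal ((enn2real (Y t \<omega>) - enn2real (Y s \<omega>)) powr p) +
    ennreal p * (\<integral>\<^sup>+u. ?h u \<omega> \<partial>lborel) \<partial>M)"
    unfolding inv_moment_def
  proof (rule nn_integral_cong_AE)
    show "AE \<omega> in M. ennpowr (Y t \<omega>) p = ennreal ((enn2real (Y t \<omega>) - enn2real (Y s \<omega>)) powr p) +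
      ennreal p * (\<integral>\<^sup>+u. ?h u \<omega> \<partial>lborel)"
      using AE_Y_finite[of t] AE_Y_finite[of s] AE_space
    proof eventually_elim
      case (elim \<omega>)
      obtain b where b: "Y t \<omega> = ennreal b" "0 \<le> b" using elim by (cases "Y t \<omega>") auto
      obtain a where a: "Y s \<omega> = ennreal a" "0 \<le> a" using elim by (cases "Y s \<omega>") auto
      have "a \<le> b" using Y_mono[OF st, of \<omega>] a b by simp
      have "(\<integral>\<^sup>+u. ?h u \<omega> \<partial>lborel) = (\<integral>\<^sup>+u. indicator {0..<a} u * ennpowr (Y t \<omega> - ennreal u) (p - 1) \<partial>lborel)"
        using nn_integral_D_le[of "\<lambda>u. ennpowr (Y t \<omega> - ennreal u) (p - 1)" \<omega> s] elim a by simp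
      also have "\<dots> = (\<integral>\<^sup>+u. indicator {0..<a} u * ennpowr (ennreal (b - u)) (p - 1) \<partial>lborel)"
        by (intro nn_integral_cong) (auto simp: b ennreal_minus split: split_indicator)
      finally show ?case
        using nn_integral_reflected_powr[OF p a(2) \<open>a \<le> b\<close>] a b p by (simp add: ennpowr_nonneg)
    qed
  qed
  also have "\<dots> = (\<integral>\<^sup>+\<omega>. ennreal ((enn2real (Y t \<omega>) - enn2real (Y s \<omega>)) powr p) \<partial>M) +
    ennreal p * (\<integral>\<^sup>+\<omega>. \<integral>\<^sup>+u. ?h u \<omega> \<partial>lborel \<partial>M)"
    by (subst nn_integral_add) (simp_all add: nn_integral_cmult)
  also have "(\<integral>\<^sup>+\<omega>. \<integral>\<^sup>+u. ?h u \<omega> \<partial>lborel \<partial>M) = (\<integral>\<^sup>+u. \<integral>\<^sup>+\<omega>. ?h u \<omega> \<partial>M \<partial>lborel)"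
    using h by (rule lborel_M_Fubini)
  \<comment> \<open>For each fixed \<open>u\<close> the Markov property replaces the residual time
    \<open>Y t - u\<close> by \<open>Y\<close> at the level \<open>t - D u\<close>, whose moment
    depends on \<open>D u\<close> alone.\<close>
  also have "\<dots> = (\<integral>\<^sup>+u. indicator {0..} u *
      (\<integral>\<^sup>+\<omega>. indicator {..s} (D (max 0 u) \<omega>) * inv_moment M Y (p - 1) (t - D (max 0 u) \<omega>) \<partial>M) \<partial>lborel)"
  proof (intro nn_integral_cong)
    fix u
    show "(\<integral>\<^sup>+\<omega>. ?h u \<omega> \<partial>M) = indicator {0..} u *
      (\<integral>\<^sup>+\<omega>. indicator {..s} (D (max 0 u) \<omega>) * inv_moment M Y (p - 1) (t - D (max 0 u) \<omega>) \<partial>M)"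
    proof (cases "0 \<le> u")
      case True
      then show ?thesis
        using Markov_property[OF True, of "\<lambda>y. ennpowr y (p - 1)" s t] by (simp add: inv_moment_def max_def)
    qed simp
  qed
  \<comment> \<open>Since \<open>D\<close> is nonnegative, \<open>{..s}\<close> may become the
    closed interval \<open>{0..s}\<close>, which retains the atom at \<open>0\<close>.\<close>
  also have "\<dots> = (\<integral>\<^sup>+u. indicator {0..} u *
      (\<integral>\<^sup>+\<omega>. inv_moment M Y (p - 1) (t - D (max 0 u) \<omega>) * indicator {0..s} (D (max 0 u) \<omega>) \<partial>M) \<partial>lborel)"
  proof (intro nn_integral_cong)
    fix u
    have "(\<integral>\<^sup>+\<omega>. indicator {..s} (D (max 0 u) \<omega>) * inv_moment M Y (p - 1) (t - D (max 0 u) \<omega>) \<partial>M) =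
      (\<integral>\<^sup>+\<omega>. inv_moment M Y (p - 1) (t - D (max 0 u) \<omega>) * indicator {0..s} (D (max 0 u) \<omega>) \<partial>M)"
      by (intro nn_integral_cong) (auto simp: D_nonneg split: split_indicator)
    then show "indicator {0..} u * (\<integral>\<^sup>+\<omega>. indicator {..s} (D (max 0 u) \<omega>) * inv_moment M Y (p - 1) (t - D (max 0 u) \<omega>) \<partial>M) =
      indicator {0..} u * (\<integral>\<^sup>+\<omega>. inv_moment M Y (p - 1) (t - D (max 0 u) \<omega>) * indicator {0..s} (D (max 0 u) \<omega>) \<partial>M)"
      by simp
  qed
  also have "\<dots> = (\<integral>\<^sup>+y\<in>{0..s}. inv_moment M Y (p - 1) (t - y) \<partial>renewal_measure M Y)"
    unfolding renewal_measure_eq_occupation by (subst nn_integral_occupation_measure) simp_all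
  finally show ?thesis .
qed

end

section \<open>Independent time change of fractional Brownian motion\<close>

text \<open>Independence of two sub-\<open>\<sigma>\<close>-algebras, phrased so that Fubini's theorem applies to
  \<open>f (\<omega>, \<omega>)\<close> although both arguments are the same outcome.\<close>

lemma (in prob_space) indep_diagonal_distr:
  assumes space: "space N1 = space M" "space N2 = space M"
    and indep: "indep_set (sets N1) (sets N2)"
  shows "(\<lambda>\<omega>. \<omega>) \<in> M \<rightarrow>\<^sub>M N1" "(\<lambda>\<omega>. \<omega>) \<in> M \<rightarrow>\<^sub>M N2"
    "distr M (N1 \<Otimes>\<^sub>M N2) (\<lambda>\<omega>. (\<omega>, \<omega>)) = distr (M \<Otimes>\<^sub>M M) (N1 \<Otimes>\<^sub>M N2) (\<lambda>p. p)"
proof -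
  have sub: "sets N1 \<subseteq> events" "sets N2 \<subseteq> events"
    using indep by (auto simp: indep_set_def indep_sets_def UNIV_bool)
  show m1: "(\<lambda>\<omega>. \<omega>) \<in> M \<rightarrow>\<^sub>M N1" and m2: "(\<lambda>\<omega>. \<omega>) \<in> M \<rightarrow>\<^sub>M N2"
    using sub by (intro measurableI; simp add: space sets.sets_into_space Int_absorb2 subsetD)+
  \<comment> \<open>The identity map into \<open>N\<close> generates the sets of \<open>N\<close>
    themselves, so independent \<open>\<sigma>\<close>-algebras become independent identity
    maps.\<close>
  have eq: "sigma_sets (space M) {(\<lambda>\<omega>. \<omega>) -` A \<inter> space M |A. A \<in> sets N} = sets N"
    if N: "space N = space M" for N :: "'a measure"
  proof -
    have "{(\<lambda>\<omega>. \<omega>) -` A \<inter> space M |A. A \<in> sets N} = sets N"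
    proof (intro equalityI subsetI)
      fix A assume A: "A \<in> sets N"
      then have "A = (\<lambda>\<omega>. \<omega>) -` A \<inter> space M"
        using sets.sets_into_space[OF A] N by auto
      with A show "A \<in> {(\<lambda>\<omega>. \<omega>) -` A \<inter> space M |A. A \<in> sets N}" by blast
    next
      fix A assume "A \<in> {(\<lambda>\<omega>. \<omega>) -` A \<inter> space M |A. A \<in> sets N}"
      then obtain A' where A': "A = A' \<inter> space M" "A' \<in> sets N" by auto
      then show "A \<in> sets N"
        using sets.sets_into_space[of A' N] N by (simp add: Int_absorb2)
    qed
    then show ?thesis by (simp add: sets.sigma_sets_eq flip: N)
  qed
  have "indep_var N1 (\<lambda>\<omega>. \<omega>) N2 (\<lambda>\<omega>. \<omega>)"
    unfolding indep_var_eq eq[OF space(1)] eq[OF space(2)] by (intro conjI m1 m2 indep)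
  then have "distr M (N1 \<Otimes>\<^sub>M N2) (\<lambda>\<omega>. (\<omega>, \<omega>)) = distr M N1 (\<lambda>\<omega>. \<omega>) \<Otimes>\<^sub>M distr M N2 (\<lambda>\<omega>. \<omega>)"
    by (simp add: indep_var_distribution_eq)
  also have "\<dots> = distr (M \<Otimes>\<^sub>M M) (N1 \<Otimes>\<^sub>M N2) (\<lambda>(x, y). (x, y))"
    using m1 m2 by (intro pair_measure_distr prob_space_imp_sigma_finite prob_space_distr)
  finally show "distr M (N1 \<Otimes>\<^sub>M N2) (\<lambda>\<omega>. (\<omega>, \<omega>)) = distr (M \<Otimes>\<^sub>M M) (N1 \<Otimes>\<^sub>M N2) (\<lambda>p. p)"
    by (simp add: id_def)
qed

lemma tendsto_floor_mult_divide: "(\<lambda>n. real_of_int \<lfloor>real (Suc n) * y\<rfloor> / real (Suc n)) \<longlonglongrightarrow> y"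
proof (rule tendsto_sandwich)
  show "\<forall>\<^sub>F n in sequentially. y - 1 / real (Suc n) \<le> real_of_int \<lfloor>real (Suc n) * y\<rfloor> / real (Suc n)"
  proof (intro always_eventually allI)
    fix n
    have "real (Suc n) * y - 1 \<le> real_of_int \<lfloor>real (Suc n) * y\<rfloor>" by linarith
    then have "(real (Suc n) * y - 1) / real (Suc n) \<le> real_of_int \<lfloor>real (Suc n) * y\<rfloor> / real (Suc n)"
      by (intro divide_right_mono) auto
    then show "y - 1 / real (Suc n) \<le> real_of_int \<lfloor>real (Suc n) * y\<rfloor> / real (Suc n)"
      by (simp add: diff_divide_distrib)
  qed
  show "\<forall>\<^sub>F n in sequentially. real_of_int \<lfloor>real (Suc n) * y\<rfloor> / real (Suc n) \<le> y"
  proof (intro always_eventually allI)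
    fix n
    have "real_of_int \<lfloor>real (Suc n) * y\<rfloor> / real (Suc n) \<le> (real (Suc n) * y) / real (Suc n)"
      by (intro divide_right_mono) auto
    then show "real_of_int \<lfloor>real (Suc n) * y\<rfloor> / real (Suc n) \<le> y" by simp
  qed
  show "(\<lambda>n. y - 1 / real (Suc n)) \<longlonglongrightarrow> y" by real_asymp
qed simp

text \<open>The random time is rounded down to a grid of mesh \<open>1 / Suc n\<close>, where it has
  countably many values; path continuity passes to the limit. Time and path use separate
  coordinates, hence separate \<open>\<sigma>\<close>-algebras.\<close>

lemma continuous_process_measurable:
  fixes B :: "real \<Rightarrow> 'a \<Rightarrow> real"
  assumes cont: "\<And>\<omega>. \<omega> \<in> space N \<Longrightarrow> continuous_on UNIV (\<lambda>t. B t \<omega>)"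
    and B: "\<And>t. B t \<in> borel_measurable N" and y: "y \<in> borel_measurable N'"
  shows "(\<lambda>p. B (y (fst p)) (snd p)) \<in> borel_measurable (N' \<Otimes>\<^sub>M N)"
proof (rule borel_measurable_LIMSEQ_real)
  let ?q = "\<lambda>n p. \<lfloor>real (Suc n) * y (fst p)\<rfloor>"
  fix p assume "p \<in> space (N' \<Otimes>\<^sub>M N)"
  then have "isCont (\<lambda>t. B t (snd p)) (y (fst p))"
    using cont by (auto simp: space_pair_measure continuous_on_eq_continuous_at)
  then show "(\<lambda>n. B (real_of_int (?q n p) / real (Suc n)) (snd p)) \<longlonglongrightarrow> B (y (fst p)) (snd p)"
    using tendsto_floor_mult_divide by (rule isCont_tendsto_compose)
next
  let ?q = "\<lambda>n p. \<lfloor>real (Suc n) * y (fst p)\<rfloor>"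
  fix n
  note [measurable] = y B
  show "(\<lambda>p. B (real_of_int (?q n p) / real (Suc n)) (snd p)) \<in> borel_measurable (N' \<Otimes>\<^sub>M N)"
    by (rule measurable_compose_countable[where f = "\<lambda>i p. B (real_of_int i / real (Suc n)) (snd p)"]) measurable
qed

lemma (in prob_space) gaussian_rv_square_integrable:
  assumes "gaussian_rv M X"
  shows "X \<in> borel_measurable M" "integrable M (\<lambda>\<omega>. X \<omega> ^ 2)"
proof -
  show X [measurable]: "X \<in> borel_measurable M" using assms by (simp add: gaussian_rv_def)
  consider m s where "0 < s" "distributed M lborel X (\<lambda>x. ennreal (normal_density m s x))"
    | m where "AE \<omega> in M. X \<omega> = m"
    using assms by (auto simp: gaussian_rv_def)
  then show "integrable M (\<lambda>\<omega>. X \<omega> ^ 2)"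
  proof cases
    fix m s assume s: "0 < s" and d: "distributed M lborel X (\<lambda>x. ennreal (normal_density m s x))"
    have *: "integrable M (\<lambda>\<omega>. (X \<omega> - m) ^ k)" for k
      using distributed_integrable[OF d, of "\<lambda>x. (x - m) ^ k"] integrable_normal_moment[OF s, of m k] by simp
    \<comment> \<open>The square of \<open>X\<close> expanded in its central moments.\<close>
    have "integrable M (\<lambda>\<omega>. (X \<omega> - m) ^ 2 + 2 * m * (X \<omega> - m) ^ 1 + m ^ 2)"
      by (intro Bochner_Integration.integrable_add integrable_mult_right *) simp
    then show ?thesis by (simp add: power2_eq_square algebra_simps)
  next
    fix m assume "AE \<omega> in M. X \<omega> = m"
    then have "integrable M (\<lambda>\<omega>. X \<omega> ^ 2) \<longleftrightarrow> integrable M (\<lambda>\<omega>. m ^ 2)"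
      by (intro integrable_cong_AE) auto
    then show ?thesis by simp
  qed
qed

lemma (in prob_space) integrable_mult_of_squares:
  fixes X Z :: "'a \<Rightarrow> real"
  assumes [measurable]: "X \<in> borel_measurable M" "Z \<in> borel_measurable M"
    and "integrable M (\<lambda>\<omega>. X \<omega> ^ 2)" "integrable M (\<lambda>\<omega>. Z \<omega> ^ 2)"
  shows "integrable M (\<lambda>\<omega>. X \<omega> * Z \<omega>)"
proof (rule Bochner_Integration.integrable_bound)
  show "integrable M (\<lambda>\<omega>. X \<omega> ^ 2 + Z \<omega> ^ 2)" using assms by simp
  have "\<bar>a * b\<bar> \<le> a ^ 2 + b ^ 2" for a b :: real
    using sum_squares_bound[of a b] sum_squares_bound[of a "- b"] zero_le_power2[of a] zero_le_power2[of b]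
    unfolding abs_le_iff power2_minus by linarith
  then show "AE \<omega> in M. norm (X \<omega> * Z \<omega>) \<le> norm (X \<omega> ^ 2 + Z \<omega> ^ 2)" by simp
qed simp

lemma (in prob_space) fractional_brownian_motionD:
  assumes fbm: "fractional_brownian_motion M H B" and \<sigma>: "\<sigma>\<^sup>2 = covariance M (B 1) (B 1)"
  shows "B t \<in> borel_measurable M" "integrable M (\<lambda>\<omega>. B t \<omega> ^ 2)"
    "integrable M (B t)" "(LINT \<omega>|M. B t \<omega>) = 0"
    "integrable M (\<lambda>\<omega>. B t \<omega> * B s \<omega>)"
    "(LINT \<omega>|M. B t \<omega> * B s \<omega>) = \<sigma>\<^sup>2 / 2 * (\<bar>s\<bar> powr (2 * H) + \<bar>t\<bar> powr (2 * H) - \<bar>t - s\<bar> powr (2 * H))"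
    "\<omega> \<in> space M \<Longrightarrow> continuous_on UNIV (\<lambda>t. B t \<omega>)"
proof -
  have "gaussian_process M B" using fbm by (simp add: fractional_brownian_motion_def)
  \<comment> \<open>A one-point linear combination with coefficient \<open>1\<close> is the marginal
    at \<open>t\<close>.\<close>
  then have "gaussian_rv M (\<lambda>\<omega>. \<Sum>t\<in>{t}. 1 * B t \<omega>)" for t
    unfolding gaussian_process_def by (elim allE[of _ "{t}"] allE[of _ "\<lambda>_. 1"]) simp
  then have g: "gaussian_rv M (B t)" for t by simp
  note m = gaussian_rv_square_integrable[OF g]
  show "B t \<in> borel_measurable M" "integrable M (\<lambda>\<omega>. B t \<omega> ^ 2)" by (rule m)+
  show "integrable M (B t)" by (rule square_integrable_imp_integrable[OF m])
  show "integrable M (\<lambda>\<omega>. B t \<omega> * B s \<omega>)" by (rule integrable_mult_of_squares[OF m(1) m(1) m(2) m(2)])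
  show "(LINT \<omega>|M. B t \<omega>) = 0" "\<omega> \<in> space M \<Longrightarrow> continuous_on UNIV (\<lambda>t. B t \<omega>)"
    "(LINT \<omega>|M. B t \<omega> * B s \<omega>) = \<sigma>\<^sup>2 / 2 * (\<bar>s\<bar> powr (2 * H) + \<bar>t\<bar> powr (2 * H) - \<bar>t - s\<bar> powr (2 * H))"
    using fbm \<sigma> by (simp_all add: fractional_brownian_motion_def)
qed

text \<open>Conditioning on the clock \<open>y\<close>: independence separates the outcomes driving
  \<open>y\<close> and \<open>B\<close>, so the covariance formula applies at fixed times in the
  inner integral. \<open>fin\<close> makes the second moments finite.\<close>

lemma (in prob_space) subordinated_fbm_covariance:
  fixes y :: "'i \<Rightarrow> 'a \<Rightarrow> real"
  assumes fbm: "fractional_brownian_motion M H B" and \<sigma>: "\<sigma>\<^sup>2 = covariance M (B 1) (B 1)"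
    and space: "space N1 = space M" "space N2 = space M"
    and indep: "indep_set (sets N1) (sets N2)"
    and y: "\<And>t. y t \<in> borel_measurable N1" and y0: "\<And>t \<omega>. 0 \<le> y t \<omega>" and B: "\<And>a. B a \<in> borel_measurable N2"
    and fin: "\<And>t. integrable M (\<lambda>\<omega>. y t \<omega> powr (2 * H))"
  defines "Z \<equiv> \<lambda>t \<omega>. B (y t \<omega>) \<omega>"
  shows "integrable M (Z t)" "integrable M (\<lambda>\<omega>. Z t \<omega> * Z s \<omega>)"
    "covariance M (Z t) (Z s) = \<sigma>\<^sup>2 / 2 *
      (LINT \<omega>|M. y s \<omega> powr (2 * H) + y t \<omega> powr (2 * H) - \<bar>y t \<omega> - y s \<omega>\<bar> powr (2 * H))"
proof -
  note fbmD = fractional_brownian_motionD[OF fbm \<sigma>]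
  note diag = indep_diagonal_distr[OF space indep]
  interpret P: pair_prob_space M M ..
  have id: "(\<lambda>p. p) \<in> M \<Otimes>\<^sub>M M \<rightarrow>\<^sub>M N1 \<Otimes>\<^sub>M N2"
  proof -
    have "(\<lambda>p. (fst p, snd p)) \<in> M \<Otimes>\<^sub>M M \<rightarrow>\<^sub>M N1 \<Otimes>\<^sub>M N2"
      by (intro measurable_Pair measurable_compose[OF measurable_fst diag(1)] measurable_compose[OF measurable_snd diag(2)])
    then show ?thesis by simp
  qed
  have dg: "(\<lambda>\<omega>. (\<omega>, \<omega>)) \<in> M \<rightarrow>\<^sub>M N1 \<Otimes>\<^sub>M N2"
    using diag by (intro measurable_Pair)
  \<comment> \<open>The time change on the product space; \<open>Z t\<close> is its restriction to
    the diagonal.\<close>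
  define G where "G = (\<lambda>t p. B (y t (fst p)) (snd p))"
  have G [measurable]: "G t \<in> borel_measurable (N1 \<Otimes>\<^sub>M N2)" for t
    unfolding G_def using fbmD(7) by (intro continuous_process_measurable y B) (simp add: space)
  have GM [measurable]: "G t \<in> borel_measurable (M \<Otimes>\<^sub>M M)" for t
    using measurable_compose[OF id G] .
  have Z_G: "Z t \<omega> = G t (\<omega>, \<omega>)" for t \<omega> by (simp add: Z_def G_def)
  have Z [measurable]: "Z t \<in> borel_measurable M" for t
    using measurable_compose[OF dg G] by (simp add: Z_def G_def)
  have integrable_iff: "integrable M (\<lambda>\<omega>. f (\<omega>, \<omega>)) \<longleftrightarrow> integrable (M \<Otimes>\<^sub>M M) f"
    if f: "f \<in> borel_measurable (N1 \<Otimes>\<^sub>M N2)" for f :: "_ \<Rightarrow> real"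
    using integrable_distr_eq[OF dg f] integrable_distr_eq[OF id f] diag(3) by simp
  have integral_eq: "(LINT \<omega>|M. f (\<omega>, \<omega>)) = (LINT p|(M \<Otimes>\<^sub>M M). f p)"
    if f: "f \<in> borel_measurable (N1 \<Otimes>\<^sub>M N2)" for f :: "_ \<Rightarrow> real"
    using integral_distr[OF dg f] integral_distr[OF id f] diag(3) by simp
  have sq: "integrable (M \<Otimes>\<^sub>M M) (\<lambda>p. G t p ^ 2)" for t
  proof (rule P.Fubini_integrable)
    show "AE \<omega> in M. integrable M (\<lambda>\<omega>'. G t (\<omega>, \<omega>') ^ 2)"
      using fbmD(2) by (simp add: G_def)
    \<comment> \<open>The covariance formula at equal times, where \<open>0 powr (2 * H) = 0\<close>
      removes the difference term.\<close>
    have "(LINT \<omega>'|M. norm (G t (\<omega>, \<omega>') ^ 2)) = \<sigma>\<^sup>2 * y t \<omega> powr (2 * H)" for \<omega>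
      using fbmD(6)[of "y t \<omega>" "y t \<omega>"] y0[of t \<omega>] by (simp add: G_def power2_eq_square)
    then show "integrable M (\<lambda>\<omega>. LINT \<omega>'|M. norm (G t (\<omega>, \<omega>') ^ 2))"
      using fin by simp
  qed measurable
  have Z_sq: "integrable M (\<lambda>\<omega>. Z t \<omega> ^ 2)" for t
    using sq[of t] integrable_iff[of "\<lambda>p. G t p ^ 2"] by (simp add: Z_G)
  show Z_int: "integrable M (Z t)" for t
    by (rule square_integrable_imp_integrable[OF Z Z_sq])
  show ZZ: "integrable M (\<lambda>\<omega>. Z t \<omega> * Z s \<omega>)"
    by (rule integrable_mult_of_squares[OF Z Z Z_sq Z_sq])
  have mean: "(LINT \<omega>|M. Z t \<omega>) = 0" for t
  proof -
    have "integrable (M \<Otimes>\<^sub>M M) (G t)"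
      using Z_int[of t] integrable_iff[of "G t"] by (simp add: Z_G[abs_def])
    then have "(LINT p|(M \<Otimes>\<^sub>M M). G t p) = (LINT \<omega>|M. LINT \<omega>'|M. G t (\<omega>, \<omega>'))"
      by (rule P.integral_fst'[symmetric])
    also have "\<dots> = 0" by (simp add: G_def fbmD(4))
    finally show ?thesis using integral_eq[of "G t"] by (simp add: Z_G)
  qed
  have "covariance M (Z t) (Z s) = (LINT \<omega>|M. Z t \<omega> * Z s \<omega>)"
    by (simp add: covariance_def mean)
  also have "\<dots> = (LINT p|(M \<Otimes>\<^sub>M M). G t p * G s p)"
    using integral_eq[of "\<lambda>p. G t p * G s p"] by (simp add: Z_G)
  also have "\<dots> = (LINT \<omega>|M. LINT \<omega>'|M. G t (\<omega>, \<omega>') * G s (\<omega>, \<omega>'))"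
    using ZZ integrable_iff[of "\<lambda>p. G t p * G s p"] by (intro P.integral_fst'[symmetric]) (simp add: Z_G)
  also have "\<dots> = (LINT \<omega>|M. \<sigma>\<^sup>2 / 2 *
      (y s \<omega> powr (2 * H) + y t \<omega> powr (2 * H) - \<bar>y t \<omega> - y s \<omega>\<bar> powr (2 * H)))"
    by (intro Bochner_Integration.integral_cong refl) (simp add: G_def fbmD(6) y0)
  finally show "covariance M (Z t) (Z s) = \<sigma>\<^sup>2 / 2 *
      (LINT \<omega>|M. y s \<omega> powr (2 * H) + y t \<omega> powr (2 * H) - \<bar>y t \<omega> - y s \<omega>\<bar> powr (2 * H))"
    by simp
qed

lemma process_sigma_coordinate:
  assumes "i \<in> I"
  shows "X i \<in> borel_measurable (vimage_algebra (space M) (\<lambda>\<omega>. \<lambda>i\<in>I. X i \<omega>) (Pi\<^sub>M I (\<lambda>_. borel)))"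
proof -
  have "(\<lambda>\<omega>. \<lambda>i\<in>I. X i \<omega>) \<in> vimage_algebra (space M) (\<lambda>\<omega>. \<lambda>i\<in>I. X i \<omega>) (Pi\<^sub>M I (\<lambda>_. borel)) \<rightarrow>\<^sub>M Pi\<^sub>M I (\<lambda>_. borel)"
    by (rule measurable_vimage_algebra1) (simp add: space_PiM)
  from measurable_compose[OF this measurable_component_singleton[OF assms]]
  show ?thesis using assms by simp
qed

lemma covariance_commute: "covariance M X Z = covariance M Z X"
  by (simp add: covariance_def mult.commute)

text \<open>\<open>moment_identity\<close> with \<open>p = 2 * H\<close> replaces the last two terms
  of the conditional covariance by the renewal integral. Finite moments allow the passage between
  real and extended integrals.\<close>

lemma (in nonzero_subordinator) covariance_via_renewal:
  fixes B :: "real \<Rightarrow> 'w \<Rightarrow> real"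
  assumes fbm: "fractional_brownian_motion M H B" and \<sigma>: "\<sigma>\<^sup>2 = covariance M (B 1) (B 1)" and H: "0 < H"
    and indep: "indep_set (process_sigma M {0..} Y) (process_sigma M UNIV B)"
    and st: "0 \<le> s" "s \<le> t"
  defines "Z \<equiv> time_changed B Y"
  shows "integrable M (Z t)" "integrable M (Z s)" "integrable M (\<lambda>\<omega>. Z t \<omega> * Z s \<omega>)"
    "ereal (covariance M (Z t) (Z s)) = ereal (\<sigma>\<^sup>2 / 2) * enn2ereal
      (inv_moment M Y (2 * H) s +
       ennreal (2 * H) * (\<integral>\<^sup>+y\<in>{0..s}. inv_moment M Y (2 * H - 1) (t - y) \<partial>renewal_measure M Y))"
proof -
  define N1 where "N1 = vimage_algebra (space M) (\<lambda>\<omega>. \<lambda>i\<in>{0..}. Y i \<omega>) (Pi\<^sub>M {0..} (\<lambda>_. borel))"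
  define N2 where "N2 = vimage_algebra (space M) (\<lambda>\<omega>. \<lambda>i\<in>UNIV. B i \<omega>) (Pi\<^sub>M UNIV (\<lambda>_. borel))"
  have space: "space N1 = space M" "space N2 = space M"
    by (simp_all add: N1_def N2_def)
  have indep': "indep_set (sets N1) (sets N2)"
    using indep by (simp only: process_sigma_def N1_def N2_def)
  \<comment> \<open>The index is clamped because the \<open>\<sigma>\<close>-algebra of
    \<open>Y\<close> is generated by nonnegative times only; \<open>enn2real\<close> matches
    \<open>time_changed\<close>.\<close>
  define y where "y = (\<lambda>i \<omega>. enn2real (Y (max 0 i) \<omega>))"
  have yN: "y i \<in> borel_measurable N1" for i
    unfolding y_def N1_def by (intro borel_measurable_enn2real process_sigma_coordinate) simp
  have yM [measurable]: "y i \<in> borel_measurable M" for i unfolding y_def by measurable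
  have BN: "B a \<in> borel_measurable N2" for a
    unfolding N2_def by (intro process_sigma_coordinate) simp
  have Y_AE: "AE \<omega> in M. Y i \<omega> = ennreal (y i \<omega>)" if "0 \<le> i" for i
    using AE_Y_finite[of i] that by (auto simp: y_def elim!: eventually_mono)
  have p: "0 < 2 * H" using H by simp
  have moment: "inv_moment M Y (2 * H) i = (\<integral>\<^sup>+\<omega>. ennreal (y i \<omega> powr (2 * H)) \<partial>M)" if "0 \<le> i" for i
    unfolding inv_moment_def using Y_AE[OF that]
    by (intro nn_integral_cong_AE) (auto simp: ennpowr_nonneg[OF _ p] y_def elim!: eventually_mono)
  have fin: "integrable M (\<lambda>\<omega>. y i \<omega> powr (2 * H))" for i
    using moment[of "max 0 i"] inv_moment_finite[OF p, of "max 0 i"]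
    by (intro integrableI_nonneg) (auto simp: y_def)
  have moment_eq: "inv_moment M Y (2 * H) i = ennreal (LINT \<omega>|M. y i \<omega> powr (2 * H))" if "0 \<le> i" for i
    using moment[OF that] nn_integral_eq_integral[OF fin] by simp
  note Cov = subordinated_fbm_covariance[OF fbm \<sigma> space indep' yN _ BN fin]
  have Z_eq: "Z i = (\<lambda>\<omega>. B (y i \<omega>) \<omega>)" if "0 \<le> i" for i
    using that by (simp add: Z_def time_changed_def[abs_def] y_def fun_eq_iff)
  have t: "0 \<le> t" using st by simp
  show "integrable M (Z t)" "integrable M (Z s)" "integrable M (\<lambda>\<omega>. Z t \<omega> * Z s \<omega>)"
    unfolding Z_eq[OF t] Z_eq[OF st(1)] by (intro Cov; simp add: y_def)+
  define d where "d = (\<lambda>\<omega>. \<bar>y t \<omega> - y s \<omega>\<bar> powr (2 * H))"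
  have mono: "AE \<omega> in M. y s \<omega> \<le> y t \<omega>"
    using Y_AE[OF t] Y_AE[OF st(1)]
  proof eventually_elim
    case (elim \<omega>)
    then have "ennreal (y s \<omega>) \<le> ennreal (y t \<omega>)"
      using Y_mono[OF st(2), of \<omega>] by simp
    then show ?case by (simp add: y_def)
  qed
  have d_int: "integrable M d"
  proof (rule Bochner_Integration.integrable_bound[OF fin[of t]])
    show "AE \<omega> in M. norm (d \<omega>) \<le> norm (y t \<omega> powr (2 * H))"
      using mono by eventually_elim (use p in \<open>auto simp: d_def y_def intro!: powr_mono2\<close>)
  qed (simp add: d_def)
  define I where "I = ennreal (2 * H) * (\<integral>\<^sup>+y\<in>{0..s}. inv_moment M Y (2 * H - 1) (t - y) \<partial>renewal_measure M Y)"
  have "ennreal (LINT \<omega>|M. y t \<omega> powr (2 * H)) = ennreal (LINT \<omega>|M. d \<omega>) + I"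
  proof -
    have "(\<integral>\<^sup>+\<omega>. ennreal ((enn2real (Y t \<omega>) - enn2real (Y s \<omega>)) powr (2 * H)) \<partial>M) = (\<integral>\<^sup>+\<omega>. ennreal (d \<omega>) \<partial>M)"
      using mono st t by (intro nn_integral_cong_AE) (auto simp: d_def y_def elim!: eventually_mono)
    also have "\<dots> = ennreal (LINT \<omega>|M. d \<omega>)"
      by (intro nn_integral_eq_integral d_int) (simp add: d_def)
    finally show ?thesis
      using moment_identity[OF p st(2)] moment_eq[OF t] by (simp add: I_def)
  qed
  \<comment> \<open>The left side is finite, so \<open>I\<close> is a real number and the identity
    may be rearranged in the reals.\<close>
  then obtain r where r: "0 \<le> r" "I = ennreal r" "(LINT \<omega>|M. y t \<omega> powr (2 * H)) = (LINT \<omega>|M. d \<omega>) + r"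
    by (cases I) (auto simp: d_def simp flip: ennreal_plus)
  have "inv_moment M Y (2 * H) s + I = ennreal ((LINT \<omega>|M. y s \<omega> powr (2 * H)) + r)"
    using r by (simp add: moment_eq[OF st(1)])
  moreover have "covariance M (Z t) (Z s) = \<sigma>\<^sup>2 / 2 * ((LINT \<omega>|M. y s \<omega> powr (2 * H)) + r)"
  proof -
    have "covariance M (Z t) (Z s) = \<sigma>\<^sup>2 / 2 *
      (LINT \<omega>|M. y s \<omega> powr (2 * H) + y t \<omega> powr (2 * H) - d \<omega>)"
      unfolding Z_eq[OF t] Z_eq[OF st(1)] d_def by (rule Cov(3)) (simp add: y_def)
    also have "(LINT \<omega>|M. y s \<omega> powr (2 * H) + y t \<omega> powr (2 * H) - d \<omega>) =
      (LINT \<omega>|M. y s \<omega> powr (2 * H)) + (LINT \<omega>|M. y t \<omega> powr (2 * H)) - (LINT \<omega>|M. d \<omega>)"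
      using fin d_int by simp
    finally show ?thesis using r by simp
  qed
  ultimately show "ereal (covariance M (Z t) (Z s)) = ereal (\<sigma>\<^sup>2 / 2) * enn2ereal
      (inv_moment M Y (2 * H) s +
       ennreal (2 * H) * (\<integral>\<^sup>+y\<in>{0..s}. inv_moment M Y (2 * H - 1) (t - y) \<partial>renewal_measure M Y))"
    using r(1) unfolding I_def by (simp add: enn2ereal_ennreal del: ennreal_plus)
qed

text \<open>The integrability claims ensure that the covariance is not a default value of the
  Bochner integral. The equality is in \<open>ereal\<close> because negative moments may be infinite
  at some levels.\<close>

theorem theorem3p1:
  fixes M :: "'w measure" and B D Z :: "real \<Rightarrow> 'w \<Rightarrow> real"
    and Y :: "real \<Rightarrow> 'w \<Rightarrow> ennreal" and \<phi> :: "real \<Rightarrow> real"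
    and U :: "real \<Rightarrow> real \<Rightarrow> ennreal" and H \<sigma> :: real
  assumes "prob_space M"
    and "0 < H" and "H < 1"
    and "fractional_brownian_motion M H B"
    and "\<sigma>\<^sup>2 = covariance M (B 1) (B 1)"
    and "subordinator M D \<phi>"
    and "\<exists>l\<ge>0. \<phi> l \<noteq> 0"
    and "Y = inverse_subordinator D"
    and "prob_space.indep_set M (process_sigma M {0..} Y) (process_sigma M UNIV B)"
    and "Z = time_changed B Y"
    and "U = inv_moment M Y"
  shows "\<forall>t\<ge>0. \<forall>s\<ge>0.
    integrable M (Z t) \<and> integrable M (Z s) \<and> integrable M (\<lambda>\<omega>. Z t \<omega> * Z s \<omega>) \<and>
    ereal (covariance M (Z t) (Z s)) =
      ereal (\<sigma>\<^sup>2 / 2) * enn2ereal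
        (U (2 * H) (min t s) +
         ennreal (2 * H) *
           (\<integral>\<^sup>+y\<in>{0..min t s}. U (2 * H - 1) (max t s - y) \<partial>(renewal_measure M Y)))"
proof -
  interpret nonzero_subordinator M D \<phi>
    using assms by (simp add: nonzero_subordinator_def nonzero_subordinator_axioms_def)
  note Cov = covariance_via_renewal[OF \<open>fractional_brownian_motion M H B\<close> \<open>\<sigma>\<^sup>2 = covariance M (B 1) (B 1)\<close> \<open>0 < H\<close>
      \<open>indep_set (process_sigma M {0..} Y) (process_sigma M UNIV B)\<close>[unfolded \<open>Y = inverse_subordinator D\<close>],
      folded \<open>Y = inverse_subordinator D\<close>, folded \<open>Z = time_changed B Y\<close> \<open>U = inv_moment M Y\<close>]
  show ?thesis
  proof (intro allI impI)
    fix t s :: real assume ts: "0 \<le> t" "0 \<le> s"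
    show "integrable M (Z t) \<and> integrable M (Z s) \<and> integrable M (\<lambda>\<omega>. Z t \<omega> * Z s \<omega>) \<and>
      ereal (covariance M (Z t) (Z s)) =
      ereal (\<sigma>\<^sup>2 / 2) * enn2ereal
        (U (2 * H) (min t s) +
         ennreal (2 * H) *
           (\<integral>\<^sup>+y\<in>{0..min t s}. U (2 * H - 1) (max t s - y) \<partial>(renewal_measure M Y)))"
    proof (cases "s \<le> t")
      case True
      then show ?thesis
        using Cov[OF ts(2) True] by (simp only: min_absorb2 max_absorb1)
    next
      \<comment> \<open>The right side is already symmetric in \<open>t\<close> and
        \<open>s\<close>; symmetry of the covariance and of the product gives the other
        order.\<close>
      case False
      then have "t \<le> s" by simp
      then show ?thesis
        using Cov[OF ts(1) \<open>t \<le> s\<close>] covariance_commute[of M "Z t" "Z s"]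
        by (simp only: min_absorb1 max_absorb2 mult.commute[of "Z t _"])
    qed
  qed
qed

end
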